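(* Let $\alpha_k$ be defined by $\alpha_k=q^{3r^2+r}$ if $k=3r-1$, $\alpha_k=q^{3r^2-r}$ if $k=3r$, $\alpha_k=-q^{3r^2+r}-q^{3r^2+5r+2}$ if $k=3r+1$. Then for every integer $p\ge1$, every positive integer $N$ and every primitive $N$th root of unity $q$, $$H_p^{(3)}(q)=q^{-1}\sum_{k=0}^{N-1}(-1)^kq^{\binom{k+1}{2}+(p-1)(k^2+k)}\alpha_k.$$
   Context: $(a)_n=\prod_{k=1}^n(1-aq^{k-1})$, $\begin{bmatrix} n\\ k\end{bmatrix}=\frac{(q)_n}{(q)_{n-k}(q)_k}$. $H_p^{(3)}(q)=\sum_{n_p\ge\cdots\ge n_1\ge0}q^{2n_p}(q^{n_p+1})_{n_p}\prod_{i=1}^{p-1}q^{n_i(n_i+1)}\begin{bmatrix} n_{i+1}\\ n_i\end{bmatrix}$; at a root of unity only finitely many terms are nonzero. *)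

theory Defs
  imports "HOL-Analysis.Analysis"
begin

definition primitive_root_of_unity :: "nat \<Rightarrow> complex \<Rightarrow> bool" where
  "primitive_root_of_unity N q \<longleftrightarrow> N > 0 \<and> q ^ N = 1 \<and> (\<forall>m. 0 < m \<and> m < N \<longrightarrow> q ^ m \<noteq> 1)"

text \<open>The q-Pochhammer symbol \<open>(a)\<^sub>n\<close> with base \<open>q\<close>; the usual \<open>(q)\<^sub>n\<close> is \<open>qpoch q q n\<close>.\<close>

definition qpoch :: "complex \<Rightarrow> complex \<Rightarrow> nat \<Rightarrow> complex" where
  "qpoch q a n = (\<Prod>k=1..n. 1 - a * q ^ (k - 1))"

text \<open>
  If \<open>q\<close> is a primitive \<open>N\<close>-th root of unity and \<open>n \<ge> N\<close>, the denominator can vanish and the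
  quotient then takes the value \<open>0\<close> instead of the value of the Gaussian polynomial.
  This does not affect \<open>H3\<close> below: by \<open>H3_term_eq_0\<close>, all summands in which such a coefficient
  occurs vanish because of their factor \<open>(q\<^bsup>n+1\<^esup>)\<^sub>n\<close>.
\<close>

definition qbinom :: "complex \<Rightarrow> nat \<Rightarrow> nat \<Rightarrow> complex" where
  "qbinom q n k = qpoch q q n / (qpoch q q (n - k) * qpoch q q k)"

text \<open>
  The summation indices \<open>n\<^sub>p \<ge> \<dots> \<ge> n\<^sub>1 \<ge> 0\<close> are functions on \<open>{1..p}\<close>,
  extended by \<open>undefined\<close> so that each tuple is counted once.
\<close>

definition index_chains :: "nat \<Rightarrow> (nat \<Rightarrow> nat) set" where
  "index_chains p = {n \<in> {1..p} \<rightarrow>\<^sub>E UNIV. mono_on {1..p} n}"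

definition H3_term :: "nat \<Rightarrow> complex \<Rightarrow> (nat \<Rightarrow> nat) \<Rightarrow> complex" where
  "H3_term p q n = q ^ (2 * n p) * qpoch q (q ^ (n p + 1)) (n p) *
     (\<Prod>i=1..p-1. q ^ (n i * (n i + 1)) * qbinom q (n (i + 1)) (n i))"

definition H3 :: "nat \<Rightarrow> complex \<Rightarrow> complex" where
  "H3 p q = (\<Sum>\<^sub>\<infinity>n\<in>index_chains p. H3_term p q n)"

text \<open>
  The three cases \<open>k = 3r - 1\<close>, \<open>k = 3r\<close> and \<open>k = 3r + 1\<close>; in each of them
  \<open>r = (k + 1) div 3\<close>. The subtraction \<open>3r\<^sup>2 - r\<close> on naturals never truncates.
\<close>

definition alpha :: "complex \<Rightarrow> nat \<Rightarrow> complex" where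
  "alpha q k = (let r = (k + 1) div 3 in
     if k mod 3 = 2 then q ^ (3 * r^2 + r)
     else if k mod 3 = 0 then q ^ (3 * r^2 - r)
     else - (q ^ (3 * r^2 + r)) - q ^ (3 * r^2 + 5 * r + 2))"

lemma alpha_cases:
  shows "r \<ge> 1 \<Longrightarrow> alpha q (3 * r - 1) = q ^ (3 * r^2 + r)"
    and "alpha q (3 * r) = q ^ (3 * r^2 - r)"
    and "alpha q (3 * r + 1) = - (q ^ (3 * r^2 + r)) - q ^ (3 * r^2 + 5 * r + 2)"
proof -
  assume "r \<ge> 1"
  then have *: "3 * r - 1 = 2 + 3 * (r - 1)" "3 * r - 1 + 1 = 3 * r" by linarith+
  have "(3 * r - 1 + 1) div 3 = r" unfolding *(2) by simp
  moreover have "(3 * r - 1) mod 3 = 2" unfolding *(1) mod_mult_self2 by simp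
  ultimately show "alpha q (3 * r - 1) = q ^ (3 * r^2 + r)"
    by (simp only: alpha_def Let_def if_True refl)
next
  have "(3 * r + 1) div 3 = r" "(3 * r) mod 3 = 0" by simp_all
  then show "alpha q (3 * r) = q ^ (3 * r^2 - r)"
    by (simp only: alpha_def Let_def) simp
next
  have "(3 * r + 1 + 1) div 3 = r" by simp
  moreover have "(3 * r + 1) mod 3 = 1" unfolding mod_mult_self4 by simp
  ultimately show "alpha q (3 * r + 1) = - (q ^ (3 * r^2 + r)) - q ^ (3 * r^2 + 5 * r + 2)"
    by (simp only: alpha_def Let_def) simp
qed

lemma H3_term_eq_0:
  assumes "primitive_root_of_unity N q" and "n p \<ge> N"
  shows "H3_term p q n = 0"
proof -
  have N: "N > 0" "q ^ N = 1" using assms(1) by (auto simp: primitive_root_of_unity_def)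
  define k where "k = N - n p mod N"
  have le: "n p mod N < N" using N by simp
  have k: "k \<in> {1..n p}" using le assms(2) by (auto simp: k_def)
  have "n p + 1 + (k - 1) = N * (n p div N) + N"
    (is "_ = ?m + N")
  proof -
    have "?m + n p mod N = n p" by (rule mult_div_mod_eq)
    with le show ?thesis unfolding k_def by linarith
  qed
  then have "q ^ (n p + 1) * q ^ (k - 1) = q ^ (N * (n p div N) + N)"
    by (simp only: power_add [symmetric])
  also have "\<dots> = 1" using N by (simp add: power_add power_mult)
  finally have "1 - q ^ (n p + 1) * q ^ (k - 1) = 0" by simp
  with k have "qpoch q (q ^ (n p + 1)) (n p) = 0"
    unfolding qpoch_def by (intro prod_zero) auto
  then show ?thesis by (simp add: H3_term_def)
qed

lemma finite_H3_support:
  assumes "primitive_root_of_unity N q" and "p \<ge> 1"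
  shows "finite {n \<in> index_chains p. H3_term p q n \<noteq> 0}"
proof (rule finite_subset)
  show "finite ({1..p} \<rightarrow>\<^sub>E {..<N})" by (intro finite_PiE) auto
  show "{n \<in> index_chains p. H3_term p q n \<noteq> 0} \<subseteq> {1..p} \<rightarrow>\<^sub>E {..<N}"
  proof
    fix n assume n: "n \<in> {n \<in> index_chains p. H3_term p q n \<noteq> 0}"
    then have "n p < N" using H3_term_eq_0[OF assms(1)] by (metis (mono_tags) mem_Collect_eq not_le)
    moreover have "n i \<le> n p" if "i \<in> {1..p}" for i
    proof -
      have "mono_on {1..p} n" using n by (simp add: index_chains_def)
      then show ?thesis by (rule mono_onD) (use that assms(2) in auto)
    qed
    moreover have "n \<in> extensional {1..p}" using n by (simp add: index_chains_def PiE_iff)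
    ultimately show "n \<in> {1..p} \<rightarrow>\<^sub>E {..<N}"
      unfolding PiE_iff by (meson lessThan_iff le_less_trans)
  qed
qed

end

theory Submission
  imports Defs
begin

text \<open>
  At a primitive \<open>N\<close>-th root of unity the factor \<open>(q\<^bsup>n+1\<^esup>)\<^sub>n\<close> kills all terms with \<open>2 n\<^sub>p \<ge> N\<close>, so
  that every \<open>(q)\<^sub>m\<close> which survives is nonzero and Bailey's lemma applies as for generic \<open>q\<close>.
  Iterating it from the unit Bailey pair relative to \<open>q\<close> turns the inner sums into a single one and gives
  \<open>H = \<Sum>\<^sub>k (-1)\<^sup>k q\<^bsup>k(k+1)/2 + (p-1)(k\<^sup>2+k)\<^esup> (D\<^sub>k - D\<^sub>k\<^sub>+\<^sub>1)\<close>, where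
  \<open>D\<^sub>k = q\<^bsup>k\<^sup>2\<^esup> \<Sum>\<^sub>n q\<^bsup>2n\<^esup> [2n, n-k]\<close> over \<open>k \<le> n < N/2\<close>.
  By \<open>q\<^sup>N = 1\<close> the factors of \<open>[2n, n-k]\<close> can be reflected, which makes \<open>D\<^sub>k\<close> a finite sum
  \<open>\<Sum>\<^sub>i (-1)\<^sup>i x\<^bsup>i(i-1)/2-i\<^esup> [m-i, i]\<close> in base \<open>x = 1/q\<close> with \<open>m = N-1-2k\<close>. Such sums go back to Schur and,
  by a pentagonal-type evaluation, are monomials or binomials depending on \<open>m\<close> modulo 3. Comparison with the
  partial sums of \<open>\<alpha>\<close> gives \<open>q D\<^sub>k = \<alpha>\<^sub>k + \<dots> + \<alpha>\<^sub>N\<^sub>-\<^sub>1\<^sub>-\<^sub>k\<close>, and summation by parts concludes, because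
  the weights are invariant under \<open>k \<mapsto> N-1-k\<close>.
\<close>

subsection \<open>Gaussian polynomials\<close>

lemma choose_two_Suc: "Suc k choose 2 = k + (k choose 2)"
  by (simp add: numeral_2_eq_2)

text \<open>Gaussian polynomials, given by the q-Pascal rule instead of a quotient: no division
  occurs, so the values stay correct at roots of unity.\<close>

fun gbin :: "'a::comm_ring_1 \<Rightarrow> nat \<Rightarrow> nat \<Rightarrow> 'a" where
  "gbin q n 0 = 1"
| "gbin q 0 (Suc k) = 0"
| "gbin q (Suc n) (Suc k) = gbin q n k + q ^ Suc k * gbin q n (Suc k)"

lemma gbin_eq_0: "n < k \<Longrightarrow> gbin q n k = 0"
  by (induction q n k rule: gbin.induct) auto

text \<open>The mirror q-Pascal rule. Expanding by the defining rule and then by the induction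
  hypothesis gives four terms, which regroup into the claim for the next row.\<close>

lemma gbin_Suc_Suc': "gbin q (Suc n) (Suc k) = q ^ (n - k) * gbin q n k + gbin q n (Suc k)"
proof (induction n arbitrary: k)
  case 0
  then show ?case by (cases k) auto
next
  case (Suc n)
  show ?case
  proof (cases k)
    case 0
    then show ?thesis using Suc[of 0] by (simp add: algebra_simps)
  next
    case k: (Suc l)
    \<comment> \<open>Natural subtraction: the exponents agree only for \<open>k \<le> n\<close>;
      otherwise \<open>gbin q n k\<close> is 0.\<close>
    have *: "q ^ Suc k * (q ^ (n - k) * gbin q n k) = q ^ (n - l) * (q ^ k * gbin q n k)"
    proof (cases "k \<le> n")
      case True
      then have "n - l = Suc (n - k)" using k by simp
      then show ?thesis by (simp add: mult_ac)
    qed (simp add: gbin_eq_0)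
    have "gbin q (Suc (Suc n)) (Suc k) = gbin q (Suc n) (Suc l) + q ^ Suc k * gbin q (Suc n) (Suc k)"
      by (simp add: k)
    also have "\<dots> = q ^ (n - l) * gbin q n l + gbin q n k + q ^ Suc k * (q ^ (n - k) * gbin q n k + gbin q n (Suc k))"
      by (simp only: Suc k)
    also have "\<dots> = q ^ (n - l) * (gbin q n l + q ^ k * gbin q n k) + (gbin q n k + q ^ Suc k * gbin q n (Suc k))"
      using * by (simp add: algebra_simps)
    also have "\<dots> = q ^ (Suc n - k) * gbin q (Suc n) k + gbin q (Suc n) (Suc k)"
      by (simp add: k)
    finally show ?thesis .
  qed
qed

text \<open>A limiting case of the q-Chu-Vandermonde sum, multiplied by (xq)_d. The mirror q-Pascal
  rule turns the sum for \<open>Suc d\<close> into (1 - x q^(d+1)) S(x) + x q^(d+1) S(xq), where S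
  is the sum for \<open>d\<close>; hence \<open>x\<close> is arbitrary in the induction.\<close>

lemma gbin_vandermonde:
  "(\<Sum>i\<le>d. x ^ i * q ^ (i\<^sup>2) * gbin q d i * (\<Prod>j=Suc i..d. 1 - x * q ^ j)) = 1"
proof (induction d arbitrary: x)
  case (Suc d)
  let ?P = "\<lambda>x i d. \<Prod>j=Suc i..d. 1 - x * q ^ j"
  let ?S = "\<lambda>x. \<Sum>i\<le>d. x ^ i * q ^ (i\<^sup>2) * gbin q d i * ?P x i d"
  have shift: "?P x (Suc i) (Suc d) = ?P (x * q) i d" for i
    by (simp only: prod.shift_bounds_cl_Suc_ivl) (simp add: mult_ac)
  have "(\<Sum>i\<le>Suc d. x ^ i * q ^ (i\<^sup>2) * gbin q (Suc d) i * ?P x i (Suc d)) =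
      ?P x 0 (Suc d) + (\<Sum>i\<le>d. x ^ Suc i * q ^ ((Suc i)\<^sup>2) * gbin q (Suc d) (Suc i) * ?P x (Suc i) (Suc d))"
    unfolding sum.atMost_Suc_shift by simp
  also have "\<dots> = (?P x 0 (Suc d) + (\<Sum>i\<le>d. x ^ Suc i * q ^ ((Suc i)\<^sup>2) * gbin q d (Suc i) * ?P x (Suc i) (Suc d)))
      + (\<Sum>i\<le>d. x ^ Suc i * q ^ ((Suc i)\<^sup>2) * (q ^ (d - i) * gbin q d i) * ?P x (Suc i) (Suc d))"
    unfolding gbin_Suc_Suc' by (simp add: algebra_simps sum.distrib)
  also have "?P x 0 (Suc d) + (\<Sum>i\<le>d. x ^ Suc i * q ^ ((Suc i)\<^sup>2) * gbin q d (Suc i) * ?P x (Suc i) (Suc d)) =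
      (\<Sum>i\<le>Suc d. x ^ i * q ^ (i\<^sup>2) * gbin q d i * ?P x i (Suc d))"
    unfolding sum.atMost_Suc_shift by simp
  also have "\<dots> = (\<Sum>i\<le>d. x ^ i * q ^ (i\<^sup>2) * gbin q d i * ?P x i (Suc d))"
    by (simp add: gbin_eq_0)
  also have "\<dots> = ?S x * (1 - x * q ^ Suc d)"
    unfolding sum_distrib_right by (intro sum.cong) (auto simp: mult_ac)
  also have "(\<Sum>i\<le>d. x ^ Suc i * q ^ ((Suc i)\<^sup>2) * (q ^ (d - i) * gbin q d i) * ?P x (Suc i) (Suc d)) =
      x * q ^ Suc d * ?S (x * q)"
    unfolding sum_distrib_left shift
  proof (intro sum.cong refl)
    fix i assume "i \<in> {..d}"
    then have "(Suc i)\<^sup>2 + (d - i) = Suc d + i + i\<^sup>2" by (simp add: power2_eq_square)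
    then have "q ^ ((Suc i)\<^sup>2) * q ^ (d - i) = q ^ Suc d * q ^ i * q ^ (i\<^sup>2)"
      by (simp only: power_add [symmetric])
    then show "x ^ Suc i * q ^ ((Suc i)\<^sup>2) * (q ^ (d - i) * gbin q d i) * ?P (x * q) i d =
        x * q ^ Suc d * ((x * q) ^ i * q ^ (i\<^sup>2) * gbin q d i * ?P (x * q) i d)"
      by (simp add: power_mult_distrib algebra_simps)
  qed
  finally show ?case by (simp only: Suc) simp
qed simp

section \<open>q-factorials and the quotient form of Gaussian polynomials\<close>

abbreviation qfact :: "complex \<Rightarrow> nat \<Rightarrow> complex" where
  "qfact q n \<equiv> qpoch q q n"

lemma qfact_eq: "qfact q n = (\<Prod>k=1..n. 1 - q ^ k)"
  unfolding qpoch_def by (intro prod.cong refl) (metis atLeastAtMost_iff power_minus_mult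
    mult.commute less_le_trans zero_less_one)

lemma qfact_0 [simp]: "qfact q 0 = 1"
  and qfact_Suc: "qfact q (Suc n) = qfact q n * (1 - q ^ Suc n)"
  by (simp_all add: qfact_eq)

lemma qfact_nonzero:
  assumes "\<And>j. 0 < j \<Longrightarrow> j \<le> r \<Longrightarrow> q ^ j \<noteq> 1" "n \<le> r"
  shows "qfact q n \<noteq> 0"
  using assms by (force simp: qfact_eq)

lemma qfact_split: "m \<le> n \<Longrightarrow> qfact q n = qfact q m * (\<Prod>j=Suc m..n. 1 - q ^ j)"
  unfolding qfact_eq by (simp add: prod.ub_add_nat [symmetric] flip: prod.union_disjoint)
    (intro prod.cong; auto)

text \<open>Denominators are cleared, so no power of \<open>q\<close> has to differ from 1. The two
  q-Pascal terms contribute (q)_n times 1 - q^(k+1) and q^(k+1) (1 - q^(n-k)), which add up to 1 -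
  q^(n+1).\<close>

lemma gbin_qfact: "k \<le> n \<Longrightarrow> gbin q n k * qfact q k * qfact q (n - k) = qfact q n"
proof (induction q n k rule: gbin.induct)
  case (3 q n k)
  have A: "gbin q n k * qfact q k * qfact q (n - k) = qfact q n" using 3 by simp
  have B: "gbin q n (Suc k) * qfact q (Suc k) * qfact q (n - k) = qfact q n * (1 - q ^ (n - k))"
  proof (cases "k = n")
    case False
    then have "n - k = Suc (n - Suc k)" using 3 by simp
    then show ?thesis using 3 False by (simp only: qfact_Suc) (simp add: mult_ac)
  qed (simp add: gbin_eq_0)
  have C: "q ^ Suc k * q ^ (n - k) = q ^ Suc n" using 3 by (simp flip: power_add power_Suc)
  have "gbin q (Suc n) (Suc k) * qfact q (Suc k) * qfact q (Suc n - Suc k) =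
     (gbin q n k * qfact q k * qfact q (n - k)) * (1 - q ^ Suc k)
      + q ^ Suc k * (gbin q n (Suc k) * qfact q (Suc k) * qfact q (n - k))"
    by (simp add: qfact_Suc algebra_simps)
  also have "\<dots> = qfact q n * (1 - q ^ Suc k * q ^ (n - k))"
    unfolding A B by (simp add: algebra_simps)
  finally show ?case unfolding C qfact_Suc .
qed simp_all

lemma primitive_root_neq_1:
  "primitive_root_of_unity N q \<Longrightarrow> 0 < j \<Longrightarrow> j < N \<Longrightarrow> q ^ j \<noteq> 1"
  by (simp add: primitive_root_of_unity_def)

text \<open>Each factor satisfies 1 - q^j = - q^j (1 - q^(-j)); the exponents add up to 1 + ... +
  i.\<close>

lemma qfact_inverse_base:
  assumes "q \<noteq> 0"
  shows "qfact q i = (-1) ^ i * q ^ (Suc i choose 2) * qfact (1 / q) i"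
proof (induction i)
  case (Suc i)
  have "1 - q ^ Suc i = - (q ^ Suc i * (1 - (1 / q) ^ Suc i))"
    using assms by (simp add: power_one_over right_diff_distrib del: power_Suc)
  then show ?case unfolding qfact_Suc Suc choose_two_Suc[of "Suc i"] power_add by simp
qed (simp add: numeral_2_eq_2)

subsection \<open>Bailey's lemma\<close>

text \<open>The kernel of Bailey pairs relative to 1. The value 0 for \<open>k > n\<close> is
  explicit because \<open>n - k\<close> would truncate to 0.\<close>

definition bailey_aux :: "complex \<Rightarrow> nat \<Rightarrow> nat \<Rightarrow> complex" where
  "bailey_aux q k n = (if k \<le> n then 1 / (qfact q (n - k) * qfact q (n + k)) else 0)"

text \<open>
  Up to the poles this is \<open>(1 - q\<^bsup>2k+1\<^esup>) / ((q)\<^bsub>n-k\<^esub> (q)\<^bsub>n+k+1\<^esub>)\<close>; in the form of a difference it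
  keeps the right value for \<open>N = 2 n + 1\<close> and \<open>k = n\<close>, where that quotient is \<open>0/0\<close>.
\<close>

definition bailey_kernel :: "complex \<Rightarrow> nat \<Rightarrow> nat \<Rightarrow> complex" where
  "bailey_kernel q k n = bailey_aux q k n - q ^ (2 * k + 1) * bailey_aux q (Suc k) n"

text \<open>Up to normalisation this is the kernel of Bailey pairs relative to \<open>q\<close>. For
  \<open>k < n\<close> a common denominator leaves (1 - q^(n+k+1)) - q^(2k+1) (1 - q^(n-k)) = 1 -
  q^(2k+1); for \<open>k = n\<close> the second term of the difference is 0.\<close>

lemma bailey_kernel_eq:
  assumes nz: "\<And>j. 0 < j \<Longrightarrow> j \<le> n + k + 1 \<Longrightarrow> q ^ j \<noteq> 1" and k: "k \<le> n"
  shows "bailey_kernel q k n = (1 - q ^ (2 * k + 1)) / (qfact q (n - k) * qfact q (n + k + 1))"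
proof (cases "k = n")
  case True
  then have "q ^ (2 * k + 1) \<noteq> 1" using nz[of "2 * k + 1"] by simp
  then have "1 - q ^ Suc (2 * k) \<noteq> 0" by (metis Suc_eq_plus1 right_minus_eq)
  then show ?thesis using True
    by (simp add: bailey_kernel_def bailey_aux_def qfact_Suc mult_2 [symmetric] del: power_Suc)
next
  case False
  with k have lt: "k < n" by simp
  have s: "n - k = Suc (n - Suc k)" using lt by simp
  define u v A B where "u = 1 - q ^ (n - k)" and "v = 1 - q ^ (n + k + 1)"
    and "A = qfact q (n - Suc k)" and "B = qfact q (n + k)"
  have "q ^ (n - k) \<noteq> 1" "q ^ (n + k + 1) \<noteq> 1"
    using nz[of "n - k"] nz[of "n + k + 1"] lt by auto
  then have uv: "u \<noteq> 0" "v \<noteq> 0" by (auto simp: u_def v_def)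
  have AB: "A \<noteq> 0" "B \<noteq> 0"
    unfolding A_def B_def by (rule qfact_nonzero[of "n + k + 1"]; use nz lt in simp)+
  have 1: "qfact q (n - k) = A * u" "qfact q (n + k + 1) = B * v" "qfact q (n + Suc k) = B * v"
    by (simp_all add: A_def B_def u_def v_def s qfact_Suc del: power_Suc)
  have "q ^ (2 * k + 1) * q ^ (n - k) = q ^ (n + k + 1)"
    using k by (simp flip: power_add power_Suc add: add.commute)
  then have "v - q ^ (2 * k + 1) * u = 1 - q ^ (2 * k + 1)"
    by (simp add: u_def v_def algebra_simps)
  moreover have "1 / (A * u * B) - c * (1 / (A * (B * v))) = (v - c * u) / (A * u * (B * v))" for c
    using uv AB by (simp add: field_simps)
  ultimately show ?thesis
    using lt unfolding bailey_kernel_def bailey_aux_def 1 by (simp add: A_def B_def 1)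
qed

text \<open>Bailey's lemma for a single index \<open>k\<close>. Writing m = k + i, the exponent
  becomes k^2 + k + (2k+1) i + i^2, and the sum is \<open>gbin_vandermonde\<close> with x = q^(2k+1)
  and d = n - k.\<close>

lemma bailey_kernel_lift:
  assumes nz: "\<And>j. 0 < j \<Longrightarrow> j \<le> 2 * n \<Longrightarrow> q ^ j \<noteq> 1" and "k \<le> n"
  shows "(\<Sum>m=k..n. q ^ (m\<^sup>2 + m) / qfact q (n - m) * bailey_kernel q k m) =
    q ^ (k\<^sup>2 + k) * bailey_kernel q k n"
\<comment> \<open>Only one summand remains for \<open>k = n\<close>. There
  \<open>bailey_kernel_eq\<close> would ask for q^(2n+1) to differ from 1, which fails when N = 2n +
  1.\<close>
proof (cases "k = n")
  case False
  define d c where "d = n - k" and "c = 2 * k + 1"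
  have n: "n = k + d" "d > 0" using assms False by (auto simp: d_def)
  have nz0: "qfact q j \<noteq> 0" if "j \<le> 2 * n" for j
    using that by (intro qfact_nonzero[of "2 * n"] nz) auto
  have ker: "bailey_kernel q k (k + i) = (1 - q ^ c) / (qfact q i * qfact q (c + i))" if "i \<le> d" for i
    using that n nz by (subst bailey_kernel_eq) (auto simp: c_def mult_2 add_ac)
  have summand: "q ^ ((k + i)\<^sup>2 + (k + i)) / qfact q (d - i) * bailey_kernel q k (k + i) =
      q ^ (k\<^sup>2 + k) * (1 - q ^ c) / (qfact q d * qfact q (c + d)) *
      ((q ^ c) ^ i * q ^ (i\<^sup>2) * gbin q d i * (\<Prod>j=Suc i..d. 1 - q ^ c * q ^ j))" if i: "i \<le> d" for i
  proof -
    have "(\<Prod>j=Suc i..d. 1 - q ^ c * q ^ j) = (\<Prod>j=Suc (c + i)..c + d. 1 - q ^ j)"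
      by (rule prod.reindex_bij_witness[of _ "\<lambda>j. j - c" "\<lambda>j. j + c"]) (auto simp: power_add mult_ac)
    then have "qfact q (c + i) * (\<Prod>j=Suc i..d. 1 - q ^ c * q ^ j) = qfact q (c + d)"
      using i by (simp add: qfact_split[of "c + i" "c + d"])
    then have P: "(\<Prod>j=Suc i..d. 1 - q ^ c * q ^ j) = qfact q (c + d) / qfact q (c + i)"
      using nz0[of "c + i"] i n by (simp add: field_simps c_def)
    have g: "gbin q d i = qfact q d / (qfact q i * qfact q (d - i))"
      using gbin_qfact[OF i, of q] nz0[of i] nz0[of "d - i"] i n by (simp add: field_simps)
    have e: "q ^ ((k + i)\<^sup>2 + (k + i)) = q ^ (k\<^sup>2 + k) * ((q ^ c) ^ i * q ^ (i\<^sup>2))"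
      unfolding power_mult [symmetric] power_add [symmetric] c_def
      by (rule arg_cong[where f = "power q"]) (simp add: power2_eq_square algebra_simps)
    have nzs: "qfact q d \<noteq> 0" "qfact q (c + d) \<noteq> 0" "qfact q (c + i) \<noteq> 0" "qfact q i \<noteq> 0" "qfact q (d - i) \<noteq> 0"
      using i n by (auto intro!: nz0 simp: c_def)
    show ?thesis unfolding P g e ker[OF i] using nzs by (simp add: field_simps)
  qed
  have "(\<Sum>m=k..n. q ^ (m\<^sup>2 + m) / qfact q (n - m) * bailey_kernel q k m) =
     (\<Sum>i\<le>d. q ^ ((k + i)\<^sup>2 + (k + i)) / qfact q (d - i) * bailey_kernel q k (k + i))"
    by (rule sum.reindex_bij_witness[of _ "\<lambda>i. k + i" "\<lambda>m. m - k"]) (auto simp: n add.commute)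
  also have "\<dots> = q ^ (k\<^sup>2 + k) * (1 - q ^ c) / (qfact q d * qfact q (c + d)) *
      (\<Sum>i\<le>d. (q ^ c) ^ i * q ^ (i\<^sup>2) * gbin q d i * (\<Prod>j=Suc i..d. 1 - q ^ c * q ^ j))"
    unfolding sum_distrib_left by (intro sum.cong refl summand) simp
  also have "\<dots> = q ^ (k\<^sup>2 + k) * (1 - q ^ c) / (qfact q d * qfact q (c + d))"
    by (simp only: gbin_vandermonde mult_1_right)
  also have "\<dots> = q ^ (k\<^sup>2 + k) * bailey_kernel q k n"
    by (simp add: n ker)
  finally show ?thesis .
qed simp

text \<open>The partial sums of the unit pair relation have a closed product form, which makes the
  relation provable by induction on \<open>k\<close>.\<close>

lemma bailey_unit_partial:
  assumes nz: "\<And>j. 0 < j \<Longrightarrow> j \<le> 2 * n \<Longrightarrow> q ^ j \<noteq> 1" and "k < n"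
  shows "(\<Sum>i\<le>k. (-1) ^ i * q ^ (i choose 2) * bailey_kernel q i n) =
    (-1) ^ k * q ^ (Suc k choose 2) * (1 - q ^ Suc k) /
      ((1 - q ^ n) * (qfact q (n - Suc k) * qfact q (n + k + 1)))"
  using \<open>k < n\<close>
proof (induction k)
  case 0
  then obtain m where n: "n = Suc m" by (cases n) auto
  have "q ^ n \<noteq> 1" using nz[of n] n by simp
  then have "1 - q ^ Suc m \<noteq> 0" using n by simp
  moreover have "bailey_kernel q 0 n = (1 - q) / (qfact q n * qfact q (n + 1))"
    using 0 nz by (subst bailey_kernel_eq) auto
  ultimately show ?case by (simp add: n qfact_Suc mult_ac numeral_2_eq_2 del: power_Suc)
next
  case (Suc k)
  define A B where "A = qfact q (n - Suc (Suc k))" and "B = qfact q (n + k + 1)"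
  define x y where "x = q ^ Suc k" and "y = q ^ (n - Suc k)"
  have s: "n - Suc k = Suc (n - Suc (Suc k))" using Suc by simp
  have A: "qfact q (n - Suc k) = A * (1 - y)"
    by (simp add: s A_def y_def qfact_Suc del: power_Suc)
  have y4: "q ^ (n + Suc k + 1) = y * x * x * q"
  proof -
    have "n + Suc k + 1 = (n - Suc k) + Suc k + Suc k + 1" using Suc.prems by simp
    then show ?thesis unfolding x_def y_def by (simp only: power_add power_one_right)
  qed
  then have B: "qfact q (n + Suc k + 1) = B * (1 - y * x * x * q)"
    by (simp add: B_def qfact_Suc del: power_Suc)
  have n: "q ^ n = y * x" using Suc.prems unfolding x_def y_def by (simp flip: power_add power_Suc)
  have "q ^ (2 * Suc k + 1) = x * x * q"
    unfolding x_def by (simp only: power_add power_one_right mult_2)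
  then have ker: "bailey_kernel q (Suc k) n = (1 - x * x * q) / (A * (1 - y) * (B * (1 - y * x * x * q)))"
    using Suc.prems nz by (subst bailey_kernel_eq) (auto simp flip: A B)
  have "q ^ n \<noteq> 1" "q ^ (n - Suc k) \<noteq> 1" "q ^ (n + Suc k + 1) \<noteq> 1" using nz[of n] nz[of "n - Suc k"] nz[of "n + Suc k + 1"] Suc.prems by auto
  then have nzs: "1 - y * x \<noteq> 0" "1 - y \<noteq> 0" "1 - y * x * x * q \<noteq> 0"
    unfolding n y4 by (auto simp: y_def)
  have nz0: "qfact q j \<noteq> 0" if "j \<le> 2 * n" for j
    using that by (intro qfact_nonzero[of "2 * n"] nz) auto
  have AB: "A \<noteq> 0" "B \<noteq> 0" unfolding A_def B_def using Suc.prems by (auto intro!: nz0)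
  have c: "q ^ (Suc (Suc k) choose 2) = q ^ (Suc k choose 2) * x"
    unfolding choose_two_Suc[of "Suc k"] x_def by (simp add: power_add mult_ac)
  \<comment> \<open>Old partial sum plus new term, without the common prefactor. Cleared of
    denominators it reads (1 - x)(1 - y x^2 q) - (1 - x^2 q)(1 - y x) = - x (1 - x q)(1 -
    y).\<close>
  have eq: "(1 - x) / ((1 - y * x) * (A * (1 - y) * B)) - (1 - x * x * q) / (A * (1 - y) * (B * (1 - y * x * x * q)))
     = - x * (1 - x * q) / ((1 - y * x) * (A * (B * (1 - y * x * x * q))))" (is "?l = ?r")
  proof -
    define a b d where "a = 1 - y * x" and "b = 1 - y" and "d = 1 - y * x * x * q"
    have "(1 - x) * d - (1 - x * x * q) * a = - x * (1 - x * q) * b"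
      by (simp add: a_def b_def d_def algebra_simps)
    then have "- x * (1 - x * q) / (a * (A * (B * d))) = ((1 - x) * d - (1 - x * x * q) * a) / (a * (A * b * (B * d)))"
      using nzs AB unfolding a_def[symmetric] b_def[symmetric] d_def[symmetric] by simp
    also have "\<dots> = (1 - x) / (a * (A * b * B)) - (1 - x * x * q) / (A * b * (B * d))"
      using nzs AB unfolding a_def[symmetric] b_def[symmetric] d_def[symmetric]
      by (simp add: diff_divide_distrib mult_ac)
    finally show ?thesis by (simp add: a_def b_def d_def)
  qed
  have "(\<Sum>i\<le>Suc k. (-1) ^ i * q ^ (i choose 2) * bailey_kernel q i n) =
     (-1) ^ k * q ^ (Suc k choose 2) * ?l"
  proof -
    have "(\<Sum>i\<le>k. (-1) ^ i * q ^ (i choose 2) * bailey_kernel q i n) =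
       (-1) ^ k * q ^ (Suc k choose 2) * ((1 - x) / ((1 - y * x) * (A * (1 - y) * B)))"
      using Suc.IH Suc.prems unfolding x_def [symmetric] B_def [symmetric] A n by simp
    moreover have "(-1) ^ Suc k * q ^ (Suc k choose 2) * bailey_kernel q (Suc k) n =
       - ((-1) ^ k * q ^ (Suc k choose 2) * ((1 - x * x * q) / (A * (1 - y) * (B * (1 - y * x * x * q)))))"
      by (simp add: ker)
    ultimately show ?thesis
      by (simp only: sum.atMost_Suc add_uminus_conv_diff
        right_diff_distrib [of "(-1) ^ k * q ^ (Suc k choose 2)"])
  qed
  also have "\<dots> = (-1) ^ Suc k * (q ^ (Suc k choose 2) * x) * (1 - x * q) /
      ((1 - y * x) * (A * (B * (1 - y * x * x * q))))"
    unfolding eq by simp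
  also have "x * q = q ^ Suc (Suc k)" by (simp add: x_def)
  finally show ?case by (simp only: A_def [symmetric] n B c)
qed

text \<open>The unit Bailey pair relative to \<open>q\<close>. For positive \<open>n\<close> the
  partial sum up to n - 1 is the negative of the last term.\<close>

lemma bailey_unit:
  assumes nz: "\<And>j. 0 < j \<Longrightarrow> j \<le> 2 * n \<Longrightarrow> q ^ j \<noteq> 1"
  shows "(\<Sum>k\<le>n. (-1) ^ k * q ^ (k choose 2) * bailey_kernel q k n) = (if n = 0 then 1 else 0)"
proof (cases n)
  case 0
  then show ?thesis by (simp add: bailey_kernel_def bailey_aux_def numeral_2_eq_2)
next
  case (Suc m)
  have "q ^ n \<noteq> 1" using nz[of n] Suc by simp
  then have n1: "1 - q ^ n \<noteq> 0" by simp
  have "m < n" using Suc by simp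
  have "(\<Sum>k\<le>m. (-1) ^ k * q ^ (k choose 2) * bailey_kernel q k n) =
      (-1) ^ m * q ^ (Suc m choose 2) * (1 - q ^ Suc m) /
      ((1 - q ^ n) * (qfact q (n - Suc m) * qfact q (n + m + 1)))"
    by (rule bailey_unit_partial[OF nz \<open>m < n\<close>])
  also have "\<dots> = (-1) ^ m * q ^ (n choose 2) / qfact q (n + n)"
    unfolding Suc [symmetric] using n1 by (simp add: Suc)
  finally have "(\<Sum>k\<le>m. (-1) ^ k * q ^ (k choose 2) * bailey_kernel q k n) =
      (-1) ^ m * q ^ (n choose 2) / qfact q (n + n)" .
  \<comment> \<open>Read off from the definition, so that q^(2n+1) = 1 is allowed.\<close>
  moreover have "bailey_kernel q n n = 1 / qfact q (n + n)"
    by (simp add: bailey_kernel_def bailey_aux_def)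
  ultimately show ?thesis unfolding Suc sum.atMost_Suc by simp
qed

text \<open>One step of the Bailey chain: the coefficient \<open>c k\<close> gains the factor
  q^(k^2+k). After the order of summation is exchanged, \<open>bailey_kernel_lift\<close> evaluates
  each inner sum.\<close>

lemma bailey_chain_step:
  assumes nz: "\<And>j. 0 < j \<Longrightarrow> j \<le> 2 * n \<Longrightarrow> q ^ j \<noteq> 1"
    and f: "\<And>m. m \<le> n \<Longrightarrow> f m = qfact q m * (\<Sum>k\<le>m. c k * bailey_kernel q k m)"
  shows "(\<Sum>m\<le>n. q ^ (m * (m + 1)) * qbinom q n m * f m) =
    qfact q n * (\<Sum>k\<le>n. c k * q ^ (k\<^sup>2 + k) * bailey_kernel q k n)"
proof -
  have nz0: "qfact q j \<noteq> 0" if "j \<le> n" for j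
    using that by (intro qfact_nonzero[of "2 * n"] nz) auto
  have "(\<Sum>m\<le>n. q ^ (m * (m + 1)) * qbinom q n m * f m) =
      (\<Sum>m\<le>n. \<Sum>k\<le>m. qfact q n * c k * (q ^ (m\<^sup>2 + m) / qfact q (n - m) * bailey_kernel q k m))"
    unfolding sum_distrib_left
    by (intro sum.cong refl)
      (simp add: f qbinom_def nz0 sum_distrib_left sum_divide_distrib power2_eq_square mult_ac add_ac)
  also have "\<dots> = (\<Sum>k\<le>n. \<Sum>m=k..n. qfact q n * c k * (q ^ (m\<^sup>2 + m) / qfact q (n - m) * bailey_kernel q k m))"
    unfolding sum.Sigma[OF finite_atMost ballI[OF finite_atMost]] sum.Sigma[OF finite_atMost ballI[OF finite_atLeastAtMost]]
    by (rule sum.reindex_bij_witness[of _ prod.swap prod.swap]) auto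
  also have "\<dots> = (\<Sum>k\<le>n. qfact q n * c k * (\<Sum>m=k..n. q ^ (m\<^sup>2 + m) / qfact q (n - m) * bailey_kernel q k m))"
    by (simp add: sum_distrib_left)
  also have "\<dots> = (\<Sum>k\<le>n. qfact q n * (c k * q ^ (k\<^sup>2 + k) * bailey_kernel q k n))"
  proof (intro sum.cong refl)
    fix k assume "k \<in> {..n}"
    then have "(\<Sum>m=k..n. q ^ (m\<^sup>2 + m) / qfact q (n - m) * bailey_kernel q k m) =
        q ^ (k\<^sup>2 + k) * bailey_kernel q k n"
      by (intro bailey_kernel_lift nz) auto
    then show "qfact q n * c k * (\<Sum>m=k..n. q ^ (m\<^sup>2 + m) / qfact q (n - m) * bailey_kernel q k m) =
        qfact q n * (c k * q ^ (k\<^sup>2 + k) * bailey_kernel q k n)"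
      by simp
  qed
  finally show ?thesis by (simp add: sum_distrib_left)
qed

text \<open>Recursive form of the sum over n_1, ..., n_j below a fixed entry n_(j+1) =
  \<open>n\<close>; \<open>sum_chains_to\<close> connects it with chains.\<close>

primrec inner_sum :: "complex \<Rightarrow> nat \<Rightarrow> nat \<Rightarrow> complex" where
  "inner_sum q 0 n = 1"
| "inner_sum q (Suc j) n = (\<Sum>m\<le>n. q ^ (m * (m + 1)) * qbinom q n m * inner_sum q j m)"

lemma inner_sum_eq:
  assumes "\<And>j. 0 < j \<Longrightarrow> j \<le> 2 * n \<Longrightarrow> q ^ j \<noteq> 1"
  shows "inner_sum q j n =
    qfact q n * (\<Sum>k\<le>n. (-1) ^ k * q ^ ((k choose 2) + (j + 1) * (k\<^sup>2 + k)) * bailey_kernel q k n)"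
  using assms
proof (induction j arbitrary: n)
  case 0
  \<comment> \<open>The constant 1 is itself one chain step applied to the indicator of
    \<open>m = 0\<close>, which belongs to the unit pair. This explains \<open>j + 1\<close> in the
    exponent.\<close>
  have "inner_sum q 0 n = (\<Sum>m\<le>n. q ^ (m * (m + 1)) * qbinom q n m * (if m = 0 then 1 else 0))"
    using qfact_nonzero[of "2 * n" q n] 0 by (simp add: qbinom_def if_distrib sum.delta cong: if_cong)
  also have "\<dots> = qfact q n * (\<Sum>k\<le>n. ((-1) ^ k * q ^ (k choose 2)) * q ^ (k\<^sup>2 + k) * bailey_kernel q k n)"
    using 0 by (intro bailey_chain_step) (auto simp: bailey_unit)
  finally show ?case by (simp add: power_add mult_ac)
next
  case (Suc j)
  have "inner_sum q (Suc j) n = (\<Sum>m\<le>n. q ^ (m * (m + 1)) * qbinom q n m * inner_sum q j m)" by simp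
  also have "\<dots> = qfact q n * (\<Sum>k\<le>n. ((-1) ^ k * q ^ ((k choose 2) + (j + 1) * (k\<^sup>2 + k))) * q ^ (k\<^sup>2 + k) * bailey_kernel q k n)"
    using Suc by (intro bailey_chain_step Suc.IH) auto
  also have "\<dots> = qfact q n * (\<Sum>k\<le>n. (-1) ^ k * q ^ ((k choose 2) + (Suc j + 1) * (k\<^sup>2 + k)) * bailey_kernel q k n)"
    by (simp add: power_add mult_ac)
  finally show ?case .
qed

subsection \<open>Schur-type sums\<close>

text \<open>A signed q-analogue of Fibonacci polynomials; only \<open>i\<close> with 2i at most
  \<open>m\<close> contribute. The variable \<open>z\<close> stays free because the recurrences
  shift it by the factor \<open>p\<close>.\<close>

definition schur_sum :: "complex \<Rightarrow> complex \<Rightarrow> nat \<Rightarrow> complex" where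
  "schur_sum p z m = (\<Sum>i\<le>m. (-1) ^ i * p ^ (i choose 2) * z ^ i * gbin p (m - i) i)"

lemma schur_sum_0 [simp]: "schur_sum p z 0 = 1"
  and schur_sum_1 [simp]: "schur_sum p z (Suc 0) = 1"
  by (simp_all add: schur_sum_def numeral_2_eq_2)

text \<open>Termwise the defining q-Pascal rule; its factor p^(i+1) is absorbed by replacing
  \<open>z\<close> with \<open>z * p\<close>.\<close>

lemma schur_sum_Suc_Suc:
  "schur_sum p z (Suc (Suc m)) = schur_sum p (z * p) (Suc m) - z * schur_sum p (z * p) m"
proof -
  let ?t = "\<lambda>z m i. (-1) ^ i * p ^ (i choose 2) * z ^ i * gbin p (m - i) i"
  have "schur_sum p z (Suc (Suc m)) = 1 + (\<Sum>i\<le>m. ?t z (Suc (Suc m)) (Suc i))"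
    unfolding schur_sum_def sum.atMost_Suc_shift[of _ "Suc m"]
    by (simp add: numeral_2_eq_2)
  also have "\<dots> = 1 + (\<Sum>i\<le>m. ?t (z * p) (Suc m) (Suc i) - z * ?t (z * p) m i)"
  proof (rule arg_cong[where f = "(+) 1"], rule sum.cong[OF refl])
    fix i assume "i \<in> {..m}"
    then have "Suc (Suc m) - Suc i = Suc (m - i)" by simp
    then show "?t z (Suc (Suc m)) (Suc i) = ?t (z * p) (Suc m) (Suc i) - z * ?t (z * p) m i"
      by (simp add: choose_two_Suc power_add power_mult_distrib algebra_simps)
  qed
  also have "\<dots> = schur_sum p (z * p) (Suc m) - z * schur_sum p (z * p) m"
    unfolding schur_sum_def sum.atMost_Suc_shift[of _ m] sum_subtractf sum_distrib_left
    by (simp add: numeral_2_eq_2)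
  finally show ?thesis .
qed

text \<open>Termwise the mirror q-Pascal rule; its factor p^(m-2i) combines with p^(2i) into a power
  independent of \<open>i\<close>.\<close>

lemma schur_sum_Suc_Suc':
  "schur_sum p (z * p) (Suc (Suc m)) = schur_sum p (z * p) (Suc m) - z * p ^ Suc m * schur_sum p z m"
proof -
  let ?t = "\<lambda>z m i. (-1) ^ i * p ^ (i choose 2) * z ^ i * gbin p (m - i) i"
  have "schur_sum p (z * p) (Suc (Suc m)) = 1 + (\<Sum>i\<le>m. ?t (z * p) (Suc (Suc m)) (Suc i))"
    unfolding schur_sum_def sum.atMost_Suc_shift[of _ "Suc m"]
    by (simp add: numeral_2_eq_2)
  also have "\<dots> = 1 + (\<Sum>i\<le>m. ?t (z * p) (Suc m) (Suc i) - z * p ^ Suc m * ?t z m i)"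
  proof (rule arg_cong[where f = "(+) 1"], rule sum.cong[OF refl])
    fix i assume i: "i \<in> {..m}"
    have e: "p ^ (i choose 2) * p ^ i * p ^ i * p ^ (m - i - i) * gbin p (m - i) i =
        p ^ m * p ^ (i choose 2) * gbin p (m - i) i"
    proof (cases "i \<le> m - i")
      case True
      then have "m = i + i + (m - i - i)" using i by simp
      then have "p ^ m = p ^ i * p ^ i * p ^ (m - i - i)" by (metis power_add)
      then show ?thesis by simp
    qed (simp add: gbin_eq_0)
    from i have "Suc (Suc m) - Suc i = Suc (m - i)" by simp
    then have "?t (z * p) (Suc (Suc m)) (Suc i) = ?t (z * p) (Suc m) (Suc i)
       - (-1) ^ i * z ^ Suc i * p * (p ^ (i choose 2) * p ^ i * p ^ i * p ^ (m - i - i) * gbin p (m - i) i)"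
      unfolding gbin_Suc_Suc' by (simp add: gbin_Suc_Suc' choose_two_Suc power_add power_mult_distrib algebra_simps del: gbin.simps)
    then show "?t (z * p) (Suc (Suc m)) (Suc i) = ?t (z * p) (Suc m) (Suc i) - z * p ^ Suc m * ?t z m i"
      unfolding e by (simp add: algebra_simps)
  qed
  also have "\<dots> = schur_sum p (z * p) (Suc m) - z * p ^ Suc m * schur_sum p z m"
    unfolding schur_sum_def sum.atMost_Suc_shift[of _ m] sum_subtractf sum_distrib_left
    by (simp add: numeral_2_eq_2)
  finally show ?thesis .
qed

text \<open>At z = 1/p the two recurrences couple the values at \<open>1\<close> and
  \<open>1 / p\<close> into a closed system, solved by simultaneous induction in steps of three. A
  square root \<open>g\<close> of \<open>p\<close> is used because the exponents of \<open>p\<close>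
  are halves, as in the pentagonal numbers (3r^2 - r)/2.\<close>

lemma schur_sum_one:
  assumes "g \<noteq> 0" "p = g\<^sup>2"
  shows "schur_sum p 1 (3 * r) = (-1) ^ r * g powi (3 * int r ^ 2 - int r)" (is "?A r")
    and "schur_sum p 1 (3 * r + 1) = (-1) ^ r * g powi (3 * int r ^ 2 + int r)" (is "?B r")
    and "schur_sum p 1 (3 * r + 2) = 0" (is "?C r")
    and "schur_sum p (1 / p) (3 * r) = (-1) ^ r * g powi (3 * int r ^ 2 - 5 * int r)" (is "?D r")
    and "schur_sum p (1 / p) (3 * r + 1) = (-1) ^ r * g powi (3 * int r ^ 2 - int r)" (is "?E r")
    and "schur_sum p (1 / p) (3 * r + 2) =
      (-1) ^ r * (g powi (3 * int r ^ 2 + int r) - g powi (3 * int r ^ 2 - int r - 2))" (is "?F r")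
proof -
  have p: "p \<noteq> 0" using assms by simp
  have pp: "p ^ n = g powi (2 * int n)" for n
    using assms by (simp add: power_int_def nat_mult_distrib power_mult)
  have pi: "1 / p = g powi (-2)" using assms by (simp add: power_int_def field_simps)
  have F: "schur_sum p 1 (Suc (Suc m)) = schur_sum p 1 (Suc m) - p ^ m * schur_sum p (1 / p) m" for m
    using schur_sum_Suc_Suc'[of p "1 / p" m] p by simp
  have G: "schur_sum p (1 / p) (Suc (Suc m)) = schur_sum p 1 (Suc m) - (1 / p) * schur_sum p 1 m" for m
    using schur_sum_Suc_Suc[of p "1 / p" m] p by simp
  note pw = power_int_add[OF disjI1[OF assms(1)], symmetric]
  have C: "?C r" and Fr: "?F r" if "?A r" "?B r" "?D r" "?E r" for r
    using that F[of "3 * r"] G[of "3 * r"]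
    by (simp_all add: pp pi pw algebra_simps)
  have "?A r \<and> ?B r \<and> ?D r \<and> ?E r"
  proof (induction r)
    case 0
    then show ?case by simp
  next
    case (Suc r)
    then have IH: "?A r" "?B r" "?D r" "?E r" by blast+
    note CC = C[OF IH] and FF = Fr[OF IH]
    have "schur_sum p 1 (3 * Suc r) = schur_sum p 1 (3 * r + 2) - p ^ (3 * r + 1) * schur_sum p (1 / p) (3 * r + 1)"
      using F[of "3 * r + 1"] by (simp add: Suc3_eq_add_3)
    then have A: "?A (Suc r)" unfolding CC IH pp
      by (simp add: pw algebra_simps power2_eq_square)
    have "schur_sum p (1 / p) (3 * Suc r) = schur_sum p 1 (3 * r + 2) - (1 / p) * schur_sum p 1 (3 * r + 1)"
      using G[of "3 * r + 1"] by (simp add: Suc3_eq_add_3)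
    then have D: "?D (Suc r)" unfolding CC IH unfolding pi
      by (simp add: pw algebra_simps power2_eq_square)
    have "schur_sum p 1 (3 * Suc r + 1) = schur_sum p 1 (3 * Suc r) - p ^ (3 * r + 2) * schur_sum p (1 / p) (3 * r + 2)"
      using F[of "3 * r + 2"] by (simp add: Suc3_eq_add_3)
    then have B: "?B (Suc r)" unfolding A FF pp
      by (simp add: pw algebra_simps power2_eq_square)
    have "schur_sum p (1 / p) (3 * Suc r + 1) = schur_sum p 1 (3 * Suc r) - (1 / p) * schur_sum p 1 (3 * r + 2)"
      using G[of "3 * r + 2"] by (simp add: Suc3_eq_add_3)
    then have E: "?E (Suc r)" unfolding A CC
      by (simp add: pw algebra_simps power2_eq_square)
    show ?case using A B D E by blast
  qed
  then show "?A r" "?B r" "?C r" "?D r" "?E r" "?F r" using C[of r] Fr[of r] by blast+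
qed

text \<open>For n = k + i the summand contains the Gaussian polynomial [2k+2i, i]. With p = 1/q and
  \<open>q ^ N = 1\<close>, reflecting 1 - q^j = 1 - p^(N-j) in its numerator and inverting the base
  of (q)_i gives (-1)^i p^(i(i+1)/2) times [m-i, i] in base \<open>p\<close>.\<close>

lemma truncated_sum_eq_schur_sum:
  assumes q: "primitive_root_of_unity N q" and N: "N = m + 1 + 2 * k"
  shows "(\<Sum>n=k..(N - 1) div 2. q ^ (2 * n) * qfact q (2 * n) * bailey_aux q k n) =
    q ^ (2 * k) * schur_sum (1 / q) q m"
proof -
  define p where "p = 1 / q"
  have qN: "q ^ N = 1" "N > 0" using q by (auto simp: primitive_root_of_unity_def)
  then have q0: "q \<noteq> 0" by (auto simp: power_0_left)
  have nzq: "qfact q j \<noteq> 0" if "j < N" for j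
    using that q by (intro qfact_nonzero[of "N - 1"] primitive_root_neq_1[of N]) auto
  have nzp: "qfact p j \<noteq> 0" if "j < N" for j
    using nzq[OF that] qfact_inverse_base[OF q0, of j] by (auto simp: p_def)
  have refl: "1 - q ^ j = 1 - p ^ (N - j)" if "j \<le> N" for j
  proof -
    have "q ^ j * q ^ (N - j) = 1" using that qN by (simp flip: power_add)
    then show ?thesis using q0 by (simp add: p_def power_divide field_simps)
  qed
  have summand: "q ^ (2 * (k + i)) * qfact q (2 * (k + i)) * bailey_aux q k (k + i) =
      q ^ (2 * k) * ((-1) ^ i * p ^ (i choose 2) * q ^ i * gbin p (m - i) i)" if i: "2 * i \<le> m" for i
  proof -
    have "(\<Prod>j=Suc (2 * k + i)..2 * k + 2 * i. 1 - q ^ j) = (\<Prod>j=Suc (m - 2 * i)..m - i. 1 - p ^ j)"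
      using i N by (intro prod.reindex_bij_witness[of _ "\<lambda>j. N - j" "\<lambda>j. N - j"]) (auto simp: refl)
    then have "qfact q (2 * k + 2 * i) * qfact p (m - 2 * i) = qfact q (2 * k + i) * qfact p (m - i)"
      using qfact_split[of "2 * k + i" "2 * k + 2 * i" q] qfact_split[of "m - 2 * i" "m - i" p] by simp
    moreover have "gbin p (m - i) i * qfact p i * qfact p (m - 2 * i) = qfact p (m - i)"
      using gbin_qfact[of i "m - i" p] i by (simp add: mult_2)
    ultimately have "qfact q (2 * k + 2 * i) * qfact p (m - 2 * i) =
        qfact q (2 * k + i) * (gbin p (m - i) i * qfact p i) * qfact p (m - 2 * i)"
      by (simp only: mult.assoc)
    then have "qfact q (2 * k + 2 * i) = qfact q (2 * k + i) * (gbin p (m - i) i * qfact p i)"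
      using nzp[of "m - 2 * i"] N by simp
    moreover have "bailey_aux q k (k + i) = 1 / (qfact q i * qfact q (2 * k + i))"
      by (simp add: bailey_aux_def mult_2 add_ac)
    ultimately have 1: "qfact q (2 * (k + i)) * bailey_aux q k (k + i) = gbin p (m - i) i * (qfact p i / qfact q i)"
      using nzq[of "2 * k + i"] i N by (simp add: distrib_left)
    have "qfact q i * ((-1) ^ i * p ^ (Suc i choose 2)) =
        (q ^ (Suc i choose 2) * p ^ (Suc i choose 2)) * ((-1) ^ i * (-1) ^ i) * qfact p i"
      unfolding qfact_inverse_base[OF q0, of i, folded p_def] by (simp only: mult_ac)
    also have "q ^ (Suc i choose 2) * p ^ (Suc i choose 2) = 1"
      using q0 by (simp add: p_def flip: power_mult_distrib)
    also have "(-1) ^ i * (-1) ^ i = (1::complex)" by (simp flip: power_mult_distrib)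
    finally have "qfact q i * ((-1) ^ i * p ^ (Suc i choose 2)) = qfact p i" by simp
    then have 2: "qfact p i / qfact q i = (-1) ^ i * p ^ (Suc i choose 2)"
      using nzq[of i] i N by (simp add: field_simps)
    have 3: "q ^ (2 * (k + i)) * p ^ (Suc i choose 2) = q ^ (2 * k) * (p ^ (i choose 2) * q ^ i)"
      using q0 by (simp add: choose_two_Suc power_add p_def power_one_over mult_2)
    have "q ^ (2 * (k + i)) * qfact q (2 * (k + i)) * bailey_aux q k (k + i) =
      q ^ (2 * (k + i)) * (qfact q (2 * (k + i)) * bailey_aux q k (k + i))" by simp
    also have "\<dots> = (q ^ (2 * (k + i)) * p ^ (Suc i choose 2)) * (-1) ^ i * gbin p (m - i) i"
      unfolding 1 2 by (simp add: mult_ac)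
    finally show ?thesis unfolding 3 by simp
  qed
  have "(\<Sum>n=k..(N - 1) div 2. q ^ (2 * n) * qfact q (2 * n) * bailey_aux q k n) =
     (\<Sum>i\<le>m div 2. q ^ (2 * (k + i)) * qfact q (2 * (k + i)) * bailey_aux q k (k + i))"
    using N by (intro sum.reindex_bij_witness[of _ "\<lambda>i. k + i" "\<lambda>n. n - k"]) auto
  also have "\<dots> = (\<Sum>i\<le>m div 2. q ^ (2 * k) * ((-1) ^ i * p ^ (i choose 2) * q ^ i * gbin p (m - i) i))"
    by (intro sum.cong summand refl) auto
  also have "\<dots> = (\<Sum>i\<le>m. q ^ (2 * k) * ((-1) ^ i * p ^ (i choose 2) * q ^ i * gbin p (m - i) i))"
    by (rule sum.mono_neutral_left) (auto simp: gbin_eq_0)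
  finally show ?thesis by (simp add: schur_sum_def p_def sum_distrib_left)
qed

subsection \<open>Partial sums of the sequence alpha\<close>

text \<open>
  The root \<open>h\<close> is chosen such that half-integral powers of \<open>q\<close> and signs are both powers of \<open>h\<close>;
  every comparison of monomials is then a congruence of exponents modulo \<open>2 N\<close>.
\<close>

lemma exists_half_root:
  assumes q: "primitive_root_of_unity N q"
  obtains h where "h \<noteq> 0" "h\<^sup>2 = q" "h ^ N = -1"
proof -
  have qN: "q ^ N = 1" "N > 0" using q by (auto simp: primitive_root_of_unity_def)
  then have q0: "q \<noteq> 0" by (auto simp: power_0_left)
  show ?thesis
  proof (cases "even N")
    \<comment> \<open>Here q^(N/2) is forced to be -1, so any square root of \<open>q\<close>
      works.\<close>
    case True
    then obtain M where M: "N = 2 * M" by blast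
    have "(q ^ M)\<^sup>2 = 1" using qN M by (simp flip: power_mult add: mult.commute)
    moreover have "q ^ M \<noteq> 1" using q qN(2) M by (intro primitive_root_neq_1[of N]) auto
    ultimately have "q ^ M = -1" by (auto simp: power2_eq_1_iff)
    moreover have "csqrt q ^ N = q ^ M" unfolding M power_mult by simp
    ultimately show ?thesis using q0 by (intro that[of "csqrt q"]) auto
  next
    case False
    then obtain M where M: "N = 2 * M + 1" using oddE by blast
    \<comment> \<open>For odd \<open>N\<close> the power q^((N+1)/2) is a square root of
      \<open>q\<close> with \<open>N\<close>-th power 1; the minus sign corrects this to -1.\<close>
    have "(- (q ^ Suc M))\<^sup>2 = q ^ (Suc M * 2)"
      by (simp only: power2_minus power_mult)
    also have "Suc M * 2 = Suc N" using M by simp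
    finally have "(- (q ^ Suc M))\<^sup>2 = q ^ N * q" by simp
    moreover have "(q ^ Suc M) ^ N = (q ^ N) ^ Suc M"
      by (simp only: power_mult [symmetric] mult.commute)
    then have "(- (q ^ Suc M)) ^ N = - ((q ^ N) ^ Suc M)"
      using False by (simp del: power_Suc)
    ultimately show ?thesis using q0 qN by (intro that[of "- (q ^ Suc M)"]) auto
  qed
qed

definition alpha_sum :: "complex \<Rightarrow> nat \<Rightarrow> complex" where
  "alpha_sum q n = (\<Sum>j<n. alpha q j)"

text \<open>Telescoping in blocks of three: 3r^2 + 5r + 2 equals 3(r+1)^2 - (r+1), so the monomial
  left over by \<open>alpha q (3 * r + 1)\<close> is the one that \<open>alpha q (3 * Suc r)\<close>
  removes.\<close>

lemma alpha_sum_eq: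
  shows "alpha_sum q (3 * r) = q ^ (3 * r^2 + r) - q ^ (3 * r^2 - r)" (is "?A r")
    and "alpha_sum q (3 * r + 1) = q ^ (3 * r^2 + r)" (is "?B r")
    and "alpha_sum q (3 * r + 2) = - (q ^ (3 * r^2 + 5 * r + 2))" (is "?C r")
proof -
  have B: "?B r" if "?A r" for r
    using that alpha_cases(2)[of q r] by (simp add: alpha_sum_def)
  have C: "?C r" if "?A r" for r
    using B[OF that] alpha_cases(3)[of q r] by (simp add: alpha_sum_def)
  have A: "?A r"
  proof (induction r)
    case 0
    then show ?case by (simp add: alpha_sum_def)
  next
    case (Suc r)
    have "alpha q (3 * r + 2) = q ^ (3 * (Suc r)\<^sup>2 + Suc r)"
      using alpha_cases(1)[of "Suc r" q] by simp
    moreover have "3 * r^2 + 5 * r + 2 = 3 * (Suc r)\<^sup>2 - Suc r"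
      by (simp add: power2_eq_square)
    moreover have "alpha_sum q (3 * Suc r) = alpha_sum q (3 * r + 2) + alpha q (3 * r + 2)"
    proof -
      have "3 * Suc r = Suc (3 * r + 2)" by simp
      then show ?thesis by (simp only: alpha_sum_def sum.lessThan_Suc)
    qed
    ultimately show ?case using C[OF Suc] by simp
  qed
  show "?A r" "?B r" "?C r" using A B[OF A] C[OF A] by simp_all
qed

text \<open>Both sides become sums of at most four powers of \<open>h\<close>, which are compared in
  the nine cases of \<open>k\<close> and \<open>m\<close> modulo 3. The assumption
  \<open>three\<close> enters through \<open>heta\<close>, in the cases where 3 divides
  \<open>N\<close>.\<close>

lemma schur_sum_eq_alpha_sum:
  fixes q h :: complex
  assumes h: "h \<noteq> 0" "h\<^sup>2 = q" "h ^ N = -1"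
    and three: "\<And>u. 3 * u = N \<Longrightarrow> q ^ u \<noteq> 1"
    and Nkm: "N = m + 1 + 2 * k"
  shows "q * (q ^ (k\<^sup>2 + 2 * k) * schur_sum (1 / q) q m) = alpha_sum q (N - k) - alpha_sum q k"
proof -
  have N: "int N = int m + 1 + 2 * int k" and Nk: "N - k = m + k + 1"
    using Nkm by simp_all
  have hN: "h powi int N = -1" using h by simp
  note pw = power_int_add[OF disjI1[OF h(1)], symmetric]
  have qp: "q ^ n = h powi (2 * int n)" for n
  proof -
    have "q ^ n = h ^ (2 * n)" using h(2) by (simp add: power_mult)
    then show ?thesis by (simp add: power_int_def nat_mult_distrib)
  qed
  have sgn: "(-1) ^ n = h powi (int N * int n)" for n
    using hN by (simp add: power_int_mult)
  \<comment> \<open>Exponents congruent modulo 2N give equal powers; a shift by an odd multiple of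
    \<open>N\<close> (next fact) changes the sign.\<close>
  have heven: "h powi a = h powi b" if "a = b + int N * (2 * x)" for a b x
  proof -
    have "h powi (int N * (2 * x)) = 1" unfolding power_int_mult hN by simp
    then show ?thesis using h that by (simp add: power_int_add)
  qed
  have hodd: "h powi a = - (h powi b)" if "a = b + int N * (2 * x + 1)" for a b x
  proof -
    have "h powi (int N * (2 * x + 1)) = -1" unfolding power_int_mult hN by (simp add: power_int_add)
    then show ?thesis using h that by (simp add: power_int_add)
  qed
  \<comment> \<open>With u = N/3 the period 2N is 6u, so exponents that agree modulo
    \<open>u\<close> give powers differing by a power of \<open>h powi u\<close>.\<close>
  have hsix: "h powi a = (h powi u) ^ r * h powi b" if "int N = 3 * u" "a = b + u * (6 * x + int r)" for a b u x r
  proof -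
    have "u * (6 * x + int r) = int N * (2 * x) + u * int r" using that(1) by (simp add: algebra_simps)
    then have "h powi a = h powi (b + u * int r)" unfolding that(2) by (intro heven[of _ _ x]) simp
    then show ?thesis using h by (simp add: power_int_add power_int_mult)
  qed
  txt \<open>
    If \<open>3\<close> divides \<open>N\<close>, the monomials do not match up in pairs; they cancel in triples instead, because
    \<open>h\<^bsup>N/3\<^esup>\<close> is a primitive sixth root of unity.
  \<close>
  have heta: "(h powi u) ^ 2 = h powi u - 1" if u: "int N = 3 * u" for u
  proof -
    let ?e = "h powi u"
    have "u \<ge> 0" using u by simp
    then have e: "?e = h ^ nat u" by (simp add: power_int_def)
    have "3 * nat u = N" using u by simp
    then have "(h ^ nat u)\<^sup>2 \<noteq> 1" using three[of "nat u"] h(2) by (metis power_mult mult.commute)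
    then have ne: "?e \<noteq> -1" using e by auto
    have "?e ^ 3 = h powi (u * 3)" by (simp add: power_int_mult)
    then have "?e ^ 3 = -1" using hN u by (simp add: mult.commute)
    then have "(?e + 1) * (?e ^ 2 - ?e + 1) = 0" by algebra
    then have "?e ^ 2 - ?e + 1 = 0" using ne by (simp add: eq_neg_iff_add_eq_0)
    then show ?thesis by algebra
  qed
  have pre: "q * (q ^ (k\<^sup>2 + 2 * k) * x) = h powi (2 * int k ^ 2 + 4 * int k + 2) * x" for x
  proof -
    have "q * q ^ (k\<^sup>2 + 2 * k) = q ^ (k\<^sup>2 + 2 * k + 1)" by simp
    also have "\<dots> = h powi (2 * int k ^ 2 + 4 * int k + 2)" unfolding qp by (simp add: algebra_simps)
    finally show ?thesis by (simp add: mult.assoc [symmetric])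
  qed
  have q0: "q \<noteq> 0" using h by auto
  have g: "1 / h \<noteq> 0" "1 / q = (1 / h)\<^sup>2" using h by (auto simp: power_divide)
  have gp: "(1 / h) powi x = h powi (- x)" for x
    by (simp add: power_int_minus power_int_divide_distrib divide_inverse power_int_inverse)
  have G: "schur_sum (1 / q) q (3 * r + 0) = h powi (int N * int r - (3 * int r ^ 2 - 5 * int r))"
    "schur_sum (1 / q) q (3 * r + 1) = h powi (int N * int r - (3 * int r ^ 2 - int r))"
    "schur_sum (1 / q) q (3 * r + 2) =
      h powi (int N * int r - (3 * int r ^ 2 + int r)) - h powi (int N * int r - (3 * int r ^ 2 - int r - 2))" for r
    using schur_sum_one(4-6)[OF g, of r] q0 unfolding gp sgn
    by (simp_all add: pw algebra_simps)
  have Q: "alpha_sum q (3 * r) = h powi (6 * int r ^ 2 + 2 * int r) - h powi (6 * int r ^ 2 - 2 * int r)"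
    "alpha_sum q (3 * r + 1) = h powi (6 * int r ^ 2 + 2 * int r)"
    "alpha_sum q (3 * r + 2) = - (h powi (6 * int r ^ 2 + 10 * int r + 4))" for r
  proof -
    have "r \<le> 3 * r\<^sup>2" by (cases r) (auto simp: power2_eq_square)
    then have e1: "2 * int (3 * r\<^sup>2 - r) = 6 * int r ^ 2 - 2 * int r" by (simp add: of_nat_diff)
    have e2: "2 * int (3 * r\<^sup>2 + r) = 6 * int r ^ 2 + 2 * int r"
      and e3: "2 * int (3 * r\<^sup>2 + 5 * r + 2) = 6 * int r ^ 2 + 10 * int r + 4" by simp_all
    show "alpha_sum q (3 * r) = h powi (6 * int r ^ 2 + 2 * int r) - h powi (6 * int r ^ 2 - 2 * int r)"
      "alpha_sum q (3 * r + 1) = h powi (6 * int r ^ 2 + 2 * int r)"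
      "alpha_sum q (3 * r + 2) = - (h powi (6 * int r ^ 2 + 10 * int r + 4))"
      by (simp_all only: alpha_sum_eq qp e1 e2 e3)
  qed
  have case00: ?thesis if k: "k = 3 * tt + 0" and m: "m = 3 * ss + 0" for ss tt
  proof -
    define s t where s_def: "s = int ss" and t_def: "t = int tt"
    have L: "q * (q ^ (k\<^sup>2 + 2 * k) * schur_sum (1 / q) q m) = h powi (6 * s * t + 6 * s + 18 * t^2 + 12 * t + 2)"
      unfolding pre m unfolding G using N by (simp add: k m pw s_def t_def algebra_simps power2_eq_square)
    have "N - k = 3 * (ss + tt) + 1" using Nk k m by simp
    then have R: "alpha_sum q (N - k) - alpha_sum q k = h powi (6 * s^2 + 12 * s * t + 2 * s + 6 * t^2 + 2 * t) - h powi (6 * t^2 + 2 * t) + h powi (6 * t^2 - 2 * t)"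
      unfolding k by (simp only: Q add_0_right) (simp add: s_def t_def algebra_simps power2_eq_square)
    \<comment> \<open>In this and the later cases the instantiated witness is the quotient of the
      difference of exponents by 2N, after N = m + 1 + 2k is expressed in \<open>s\<close> and
      \<open>t\<close>.\<close>
    have e0: "h powi (6 * s * t + 6 * s + 18 * t^2 + 12 * t + 2) = h powi (6 * t^2 - 2 * t)"
      by (rule heven[of _ _ "t + 1"], simp add: N k m s_def t_def algebra_simps power2_eq_square)
    have e1: "h powi (6 * s^2 + 12 * s * t + 2 * s + 6 * t^2 + 2 * t) = h powi (6 * t^2 + 2 * t)"
      by (rule heven[of _ _ "s"], simp add: N k m s_def t_def algebra_simps power2_eq_square)
    show ?thesis unfolding L R using e0 e1 by simp
  qed
  have case01: ?thesis if k: "k = 3 * tt + 0" and m: "m = 3 * ss + 1" for ss tt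
  proof -
    define s t where s_def: "s = int ss" and t_def: "t = int tt"
    have L: "q * (q ^ (k\<^sup>2 + 2 * k) * schur_sum (1 / q) q m) = h powi (6 * s * t + 3 * s + 18 * t^2 + 12 * t + 2)"
      unfolding pre m unfolding G using N by (simp add: k m pw s_def t_def algebra_simps power2_eq_square)
    have "N - k = 3 * (ss + tt) + 2" using Nk k m by simp
    then have R: "alpha_sum q (N - k) - alpha_sum q k = - (h powi (6 * s^2 + 12 * s * t + 10 * s + 6 * t^2 + 10 * t + 4)) - h powi (6 * t^2 + 2 * t) + h powi (6 * t^2 - 2 * t)"
      unfolding k by (simp only: Q add_0_right) (simp add: s_def t_def algebra_simps power2_eq_square)
    have e0: "h powi (6 * s * t + 3 * s + 18 * t^2 + 12 * t + 2) = - (h powi (6 * t^2 + 2 * t))"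
      by (rule hodd[of _ _ "t"], simp add: N k m s_def t_def algebra_simps power2_eq_square)
    have e1: "h powi (6 * s^2 + 12 * s * t + 10 * s + 6 * t^2 + 10 * t + 4) = h powi (6 * t^2 - 2 * t)"
      by (rule heven[of _ _ "s + 1"], simp add: N k m s_def t_def algebra_simps power2_eq_square)
    show ?thesis unfolding L R using e0 e1 by simp
  qed
  have case02: ?thesis if k: "k = 3 * tt + 0" and m: "m = 3 * ss + 2" for ss tt
  proof -
    define s t where s_def: "s = int ss" and t_def: "t = int tt"
    have L: "q * (q ^ (k\<^sup>2 + 2 * k) * schur_sum (1 / q) q m) = h powi (6 * s * t + 2 * s + 18 * t^2 + 12 * t + 2) - h powi (6 * s * t + 4 * s + 18 * t^2 + 12 * t + 4)"
      unfolding pre m unfolding G using N by (simp add: k m pw s_def t_def algebra_simps power2_eq_square)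
    have "N - k = 3 * (ss + tt + 1) + 0" using Nk k m by simp
    then have R: "alpha_sum q (N - k) - alpha_sum q k = h powi (6 * s^2 + 12 * s * t + 14 * s + 6 * t^2 + 14 * t + 8) - h powi (6 * s^2 + 12 * s * t + 10 * s + 6 * t^2 + 10 * t + 4) - h powi (6 * t^2 + 2 * t) + h powi (6 * t^2 - 2 * t)"
      unfolding k by (simp only: Q add_0_right) (simp add: s_def t_def algebra_simps power2_eq_square)
    \<comment> \<open>Here u = N/3. Each monomial on the left forms a triple with two on the right,
      which are its multiples by the second and fourth powers of e = \<open>h powi u\<close>; the
      triple cancels because e^2 + e^4 = -1.\<close>
    define u where "u = s + 2 * t + 1"
    have Nu: "int N = 3 * u" using N by (simp add: u_def k m s_def t_def)
    have e0: "h powi (6 * s^2 + 12 * s * t + 10 * s + 6 * t^2 + 10 * t + 4) = (h powi u) ^ 2 * h powi (6 * s * t + 2 * s + 18 * t^2 + 12 * t + 2)"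
      by (rule hsix[OF Nu, of _ _ "s - t"], simp add: u_def algebra_simps power2_eq_square)
    have e1: "h powi (6 * t^2 + 2 * t) = (h powi u) ^ 4 * h powi (6 * s * t + 2 * s + 18 * t^2 + 12 * t + 2)"
      by (rule hsix[OF Nu, of _ _ "- t - 1"], simp add: u_def algebra_simps power2_eq_square)
    have e2: "h powi (6 * s^2 + 12 * s * t + 14 * s + 6 * t^2 + 14 * t + 8) = (h powi u) ^ 4 * h powi (6 * s * t + 4 * s + 18 * t^2 + 12 * t + 4)"
      by (rule hsix[OF Nu, of _ _ "s - t"], simp add: u_def algebra_simps power2_eq_square)
    have e3: "h powi (6 * t^2 - 2 * t) = (h powi u) ^ 2 * h powi (6 * s * t + 4 * s + 18 * t^2 + 12 * t + 4)"
      by (rule hsix[OF Nu, of _ _ "- t - 1"], simp add: u_def algebra_simps power2_eq_square)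
    have eta: "(h powi u) ^ 2 = h powi u - 1" by (rule heta[OF Nu])
    have eta4: "(h powi u) ^ 4 = - (h powi u)" "(h powi u) ^ 5 = 1 - h powi u" using eta by algebra+
    show ?thesis unfolding L R e0 e1 e2 e3 eta eta4 power_one_right by (simp add: algebra_simps)
  qed
  have case10: ?thesis if k: "k = 3 * tt + 1" and m: "m = 3 * ss + 0" for ss tt
  proof -
    define s t where s_def: "s = int ss" and t_def: "t = int tt"
    have L: "q * (q ^ (k\<^sup>2 + 2 * k) * schur_sum (1 / q) q m) = h powi (6 * s * t + 8 * s + 18 * t^2 + 24 * t + 8)"
      unfolding pre m unfolding G using N by (simp add: k m pw s_def t_def algebra_simps power2_eq_square)
    have "N - k = 3 * (ss + tt) + 2" using Nk k m by simp
    then have R: "alpha_sum q (N - k) - alpha_sum q k = - (h powi (6 * s^2 + 12 * s * t + 10 * s + 6 * t^2 + 10 * t + 4)) - h powi (6 * t^2 + 2 * t)"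
      unfolding k by (simp only: Q add_0_right) (simp add: s_def t_def algebra_simps power2_eq_square)
    define u where "u = s + 2 * t + 1"
    have Nu: "int N = 3 * u" using N by (simp add: u_def k m s_def t_def)
    have e0: "h powi (6 * s^2 + 12 * s * t + 10 * s + 6 * t^2 + 10 * t + 4) = (h powi u) ^ 2 * h powi (6 * s * t + 8 * s + 18 * t^2 + 24 * t + 8)"
      by (rule hsix[OF Nu, of _ _ "s - t - 1"], simp add: u_def algebra_simps power2_eq_square)
    have e1: "h powi (6 * t^2 + 2 * t) = (h powi u) ^ 4 * h powi (6 * s * t + 8 * s + 18 * t^2 + 24 * t + 8)"
      by (rule hsix[OF Nu, of _ _ "- t - 2"], simp add: u_def algebra_simps power2_eq_square)
    have eta: "(h powi u) ^ 2 = h powi u - 1" by (rule heta[OF Nu])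
    have eta4: "(h powi u) ^ 4 = - (h powi u)" "(h powi u) ^ 5 = 1 - h powi u" using eta by algebra+
    show ?thesis unfolding L R e0 e1 eta eta4 power_one_right by (simp add: algebra_simps)
  qed
  have case11: ?thesis if k: "k = 3 * tt + 1" and m: "m = 3 * ss + 1" for ss tt
  proof -
    define s t where s_def: "s = int ss" and t_def: "t = int tt"
    have L: "q * (q ^ (k\<^sup>2 + 2 * k) * schur_sum (1 / q) q m) = h powi (6 * s * t + 5 * s + 18 * t^2 + 24 * t + 8)"
      unfolding pre m unfolding G using N by (simp add: k m pw s_def t_def algebra_simps power2_eq_square)
    have "N - k = 3 * (ss + tt + 1) + 0" using Nk k m by simp
    then have R: "alpha_sum q (N - k) - alpha_sum q k = h powi (6 * s^2 + 12 * s * t + 14 * s + 6 * t^2 + 14 * t + 8) - h powi (6 * s^2 + 12 * s * t + 10 * s + 6 * t^2 + 10 * t + 4) - h powi (6 * t^2 + 2 * t)"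
      unfolding k by (simp only: Q add_0_right) (simp add: s_def t_def algebra_simps power2_eq_square)
    have e0: "h powi (6 * s * t + 5 * s + 18 * t^2 + 24 * t + 8) = - (h powi (6 * s^2 + 12 * s * t + 10 * s + 6 * t^2 + 10 * t + 4))"
      by (rule hodd[of _ _ "- s + t"], simp add: N k m s_def t_def algebra_simps power2_eq_square)
    have e1: "h powi (6 * s^2 + 12 * s * t + 14 * s + 6 * t^2 + 14 * t + 8) = h powi (6 * t^2 + 2 * t)"
      by (rule heven[of _ _ "s + 1"], simp add: N k m s_def t_def algebra_simps power2_eq_square)
    show ?thesis unfolding L R using e0 e1 by simp
  qed
  have case12: ?thesis if k: "k = 3 * tt + 1" and m: "m = 3 * ss + 2" for ss tt
  proof -
    define s t where s_def: "s = int ss" and t_def: "t = int tt"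
    have L: "q * (q ^ (k\<^sup>2 + 2 * k) * schur_sum (1 / q) q m) = h powi (6 * s * t + 4 * s + 18 * t^2 + 24 * t + 8) - h powi (6 * s * t + 6 * s + 18 * t^2 + 24 * t + 10)"
      unfolding pre m unfolding G using N by (simp add: k m pw s_def t_def algebra_simps power2_eq_square)
    have "N - k = 3 * (ss + tt + 1) + 1" using Nk k m by simp
    then have R: "alpha_sum q (N - k) - alpha_sum q k = h powi (6 * s^2 + 12 * s * t + 14 * s + 6 * t^2 + 14 * t + 8) - h powi (6 * t^2 + 2 * t)"
      unfolding k by (simp only: Q add_0_right) (simp add: s_def t_def algebra_simps power2_eq_square)
    have e0: "h powi (6 * s * t + 4 * s + 18 * t^2 + 24 * t + 8) = h powi (6 * s^2 + 12 * s * t + 14 * s + 6 * t^2 + 14 * t + 8)"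
      by (rule heven[of _ _ "- s + t"], simp add: N k m s_def t_def algebra_simps power2_eq_square)
    have e1: "h powi (6 * s * t + 6 * s + 18 * t^2 + 24 * t + 10) = h powi (6 * t^2 + 2 * t)"
      by (rule heven[of _ _ "t + 1"], simp add: N k m s_def t_def algebra_simps power2_eq_square)
    show ?thesis unfolding L R using e0 e1 by simp
  qed
  have case20: ?thesis if k: "k = 3 * tt + 2" and m: "m = 3 * ss + 0" for ss tt
  proof -
    define s t where s_def: "s = int ss" and t_def: "t = int tt"
    have L: "q * (q ^ (k\<^sup>2 + 2 * k) * schur_sum (1 / q) q m) = h powi (6 * s * t + 10 * s + 18 * t^2 + 36 * t + 18)"
      unfolding pre m unfolding G using N by (simp add: k m pw s_def t_def algebra_simps power2_eq_square)
    have "N - k = 3 * (ss + tt + 1) + 0" using Nk k m by simp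
    then have R: "alpha_sum q (N - k) - alpha_sum q k = h powi (6 * s^2 + 12 * s * t + 14 * s + 6 * t^2 + 14 * t + 8) - h powi (6 * s^2 + 12 * s * t + 10 * s + 6 * t^2 + 10 * t + 4) + h powi (6 * t^2 + 10 * t + 4)"
      unfolding k by (simp only: Q add_0_right) (simp add: s_def t_def algebra_simps power2_eq_square)
    have e0: "h powi (6 * s * t + 10 * s + 18 * t^2 + 36 * t + 18) = h powi (6 * s^2 + 12 * s * t + 14 * s + 6 * t^2 + 14 * t + 8)"
      by (rule heven[of _ _ "- s + t + 1"], simp add: N k m s_def t_def algebra_simps power2_eq_square)
    have e1: "h powi (6 * s^2 + 12 * s * t + 10 * s + 6 * t^2 + 10 * t + 4) = h powi (6 * t^2 + 10 * t + 4)"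
      by (rule heven[of _ _ "s"], simp add: N k m s_def t_def algebra_simps power2_eq_square)
    show ?thesis unfolding L R using e0 e1 by simp
  qed
  have case21: ?thesis if k: "k = 3 * tt + 2" and m: "m = 3 * ss + 1" for ss tt
  proof -
    define s t where s_def: "s = int ss" and t_def: "t = int tt"
    have L: "q * (q ^ (k\<^sup>2 + 2 * k) * schur_sum (1 / q) q m) = h powi (6 * s * t + 7 * s + 18 * t^2 + 36 * t + 18)"
      unfolding pre m unfolding G using N by (simp add: k m pw s_def t_def algebra_simps power2_eq_square)
    have "N - k = 3 * (ss + tt + 1) + 1" using Nk k m by simp
    then have R: "alpha_sum q (N - k) - alpha_sum q k = h powi (6 * s^2 + 12 * s * t + 14 * s + 6 * t^2 + 14 * t + 8) + h powi (6 * t^2 + 10 * t + 4)"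
      unfolding k by (simp only: Q add_0_right) (simp add: s_def t_def algebra_simps power2_eq_square)
    define u where "u = s + 2 * t + 2"
    have Nu: "int N = 3 * u" using N by (simp add: u_def k m s_def t_def)
    have e0: "h powi (6 * s^2 + 12 * s * t + 14 * s + 6 * t^2 + 14 * t + 8) = (h powi u) ^ 1 * h powi (6 * s * t + 7 * s + 18 * t^2 + 36 * t + 18)"
      by (rule hsix[OF Nu, of _ _ "s - t - 1"], simp add: u_def algebra_simps power2_eq_square)
    have e1: "h powi (6 * t^2 + 10 * t + 4) = (h powi u) ^ 5 * h powi (6 * s * t + 7 * s + 18 * t^2 + 36 * t + 18)"
      by (rule hsix[OF Nu, of _ _ "- t - 2"], simp add: u_def algebra_simps power2_eq_square)
    have eta: "(h powi u) ^ 2 = h powi u - 1" by (rule heta[OF Nu])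
    have eta4: "(h powi u) ^ 4 = - (h powi u)" "(h powi u) ^ 5 = 1 - h powi u" using eta by algebra+
    show ?thesis unfolding L R e0 e1 eta eta4 power_one_right by (simp add: algebra_simps)
  qed
  have case22: ?thesis if k: "k = 3 * tt + 2" and m: "m = 3 * ss + 2" for ss tt
  proof -
    define s t where s_def: "s = int ss" and t_def: "t = int tt"
    have L: "q * (q ^ (k\<^sup>2 + 2 * k) * schur_sum (1 / q) q m) = h powi (6 * s * t + 6 * s + 18 * t^2 + 36 * t + 18) - h powi (6 * s * t + 8 * s + 18 * t^2 + 36 * t + 20)"
      unfolding pre m unfolding G using N by (simp add: k m pw s_def t_def algebra_simps power2_eq_square)
    have "N - k = 3 * (ss + tt + 1) + 2" using Nk k m by simp
    then have R: "alpha_sum q (N - k) - alpha_sum q k = - (h powi (6 * s^2 + 12 * s * t + 22 * s + 6 * t^2 + 22 * t + 20)) + h powi (6 * t^2 + 10 * t + 4)"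
      unfolding k by (simp only: Q add_0_right) (simp add: s_def t_def algebra_simps power2_eq_square)
    have e0: "h powi (6 * s * t + 6 * s + 18 * t^2 + 36 * t + 18) = h powi (6 * t^2 + 10 * t + 4)"
      by (rule heven[of _ _ "t + 1"], simp add: N k m s_def t_def algebra_simps power2_eq_square)
    have e1: "h powi (6 * s * t + 8 * s + 18 * t^2 + 36 * t + 20) = h powi (6 * s^2 + 12 * s * t + 22 * s + 6 * t^2 + 22 * t + 20)"
      by (rule heven[of _ _ "- s + t"], simp add: N k m s_def t_def algebra_simps power2_eq_square)
    show ?thesis unfolding L R using e0 e1 by simp
  qed
  have "\<exists>t c. k = 3 * t + c \<and> c < 3" "\<exists>s d. m = 3 * s + d \<and> d < 3"
    by (metis mult_div_mod_eq mod_less_divisor zero_less_numeral)+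
  then obtain s t c d where *: "k = 3 * t + c" "c < 3" "m = 3 * s + d" "d < 3" by blast
  have "c = 0 \<or> c = 1 \<or> c = 2" "d = 0 \<or> d = 1 \<or> d = 2" using * by auto
  with *(1,3) show ?thesis
    using case00 case01 case02 case10 case11 case12 case20 case21 case22 by metis
qed

text \<open>The quantity D_k of the overview: \<open>qfact q (2 * n) * bailey_aux q k n\<close> is
  the Gaussian polynomial [2n, n-k] for \<open>n\<close> in the range. The sum is empty once
  \<open>k\<close> exceeds \<open>(N - 1) div 2\<close>.\<close>

definition theta_block :: "nat \<Rightarrow> complex \<Rightarrow> nat \<Rightarrow> complex" where
  "theta_block N q k = q ^ (k\<^sup>2) * (\<Sum>n=k..(N - 1) div 2. q ^ (2 * n) * qfact q (2 * n) * bailey_aux q k n)"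

lemma theta_block_eq:
  assumes q: "primitive_root_of_unity N q" and k: "2 * k < N"
  shows "q * theta_block N q k = alpha_sum q (N - k) - alpha_sum q k"
proof -
  define m where "m = N - 1 - 2 * k"
  have N: "N = m + 1 + 2 * k" using k by (simp add: m_def)
  obtain h where h: "h \<noteq> 0" "h\<^sup>2 = q" "h ^ N = -1" using exists_half_root[OF q] .
  have "q * theta_block N q k = q * (q ^ (k\<^sup>2 + 2 * k) * schur_sum (1 / q) q m)"
    unfolding theta_block_def truncated_sum_eq_schur_sum[OF q N] by (simp add: power_add)
  also have "\<dots> = alpha_sum q (N - k) - alpha_sum q k"
    using h _ N by (rule schur_sum_eq_alpha_sum) (use N in \<open>intro primitive_root_neq_1[OF q]; simp\<close>)
  finally show ?thesis .
qed

subsection \<open>Summation by parts\<close>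

text \<open>Since \<open>t k\<close> is the sum of \<open>a\<close> from \<open>k\<close> to N-1-k,
  the difference \<open>t k - t (Suc k)\<close> consists of the two end terms, and the symmetry of
  \<open>w\<close> gives each its own weight.\<close>

lemma symmetric_sum_by_parts:
  fixes w a :: "nat \<Rightarrow> 'a::comm_ring_1"
  assumes w: "\<And>k. k < N \<Longrightarrow> w (N - 1 - k) = w k" and N: "N > 0"
    and t: "\<And>k. 2 * k < N \<Longrightarrow> t k = (\<Sum>j<N-k. a j) - (\<Sum>j<k. a j)"
    and t0: "t (Suc ((N - 1) div 2)) = 0"
  shows "(\<Sum>k\<le>(N - 1) div 2. w k * (t k - t (Suc k))) = (\<Sum>k<N. w k * a k)"
proof -
  let ?s = "\<lambda>n. \<Sum>j<n. a j"
  define M where "M = (N - 1) div 2"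
  have low: "t k - t (Suc k) = a k + a (N - 1 - k)" if "k < M" for k
  proof -
    have k: "2 * k < N" "2 * Suc k < N" using that by (auto simp: M_def)
    then have "N - k = Suc (N - 1 - k)" "N - Suc k = N - 1 - k" by auto
    then have "t k = ?s (Suc (N - 1 - k)) - ?s k" "t (Suc k) = ?s (N - 1 - k) - ?s (Suc k)"
      by (simp_all only: t[OF k(1)] t[OF k(2)])
    then show ?thesis by simp
  qed
  have "(\<Sum>k\<le>M. w k * (t k - t (Suc k))) = (\<Sum>k<M. w k * (t k - t (Suc k))) + w M * t M"
    using t0 by (simp add: M_def flip: lessThan_Suc_atMost)
  also have "(\<Sum>k<M. w k * (t k - t (Suc k))) = (\<Sum>k<M. w k * a k) + (\<Sum>k<M. w k * a (N - 1 - k))"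
    by (simp add: low ring_distribs sum.distrib)
  also have "(\<Sum>k<M. w k * a (N - 1 - k)) = (\<Sum>k=N-M..<N. w k * a k)"
  proof (rule sum.reindex_bij_witness[of _ "\<lambda>k. N - 1 - k" "\<lambda>k. N - 1 - k"])
    fix k assume "k \<in> {..<M}"
    then have "k < N" by (auto simp: M_def)
    then show "w (N - 1 - k) * a (N - 1 - k) = w k * a (N - 1 - k)" by (simp only: w)
  qed (auto simp: M_def)
  \<comment> \<open>The innermost block: one index for odd \<open>N\<close>, two indices of equal
    weight for even \<open>N\<close>.\<close>
  also have "w M * t M = (\<Sum>k=M..<N-M. w k * a k)"
  proof -
    have "w k = w M" if "k \<in> {M..<N-M}" for k
    proof -
      have "N = 2 * M + 1 \<or> N = 2 * M + 2" using N unfolding M_def by presburger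
      then have "k = M \<or> k = N - 1 - M" using that by auto
      then show ?thesis using w[of M] N by (auto simp: M_def)
    qed
    then have "(\<Sum>k=M..<N-M. w k * a k) = w M * (\<Sum>k=M..<N-M. a k)"
      unfolding sum_distrib_left by (intro sum.cong refl arg_cong2[where f = "(*)"])
    also have "(\<Sum>k=M..<N-M. a k) = ?s (N - M) - ?s M"
      unfolding lessThan_atLeast0 using sum.atLeastLessThan_concat[of 0 M "N - M" a] N
      by (simp add: M_def algebra_simps)
    also have "\<dots> = t M" using N by (subst t) (auto simp: M_def)
    finally show ?thesis by simp
  qed
  also have "(\<Sum>k<M. w k * a k) + (\<Sum>k=N-M..<N. w k * a k) + (\<Sum>k=M..<N-M. w k * a k) = (\<Sum>k<N. w k * a k)"
  proof -
    have "M \<le> N - M" using N by (auto simp: M_def)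
    then have "(\<Sum>k=0..<N-M. w k * a k) = (\<Sum>k=0..<M. w k * a k) + (\<Sum>k=M..<N-M. w k * a k)"
      by (intro sum.atLeastLessThan_concat [symmetric]) auto
    moreover have "(\<Sum>k=0..<N. w k * a k) = (\<Sum>k=0..<N-M. w k * a k) + (\<Sum>k=N-M..<N. w k * a k)"
      by (intro sum.atLeastLessThan_concat [symmetric]) auto
    ultimately show ?thesis by (simp only: lessThan_atLeast0 add_ac)
  qed
  finally show ?thesis by (simp add: M_def)
qed

text \<open>In terms of \<open>h\<close> the weight is (-1)^k h^((2p+1) k (k+1)). If a + b + 1 = N
  and a = b + d, then a(a+1) - b(b+1) = N d, and h^((2p+1) N d) = (-1)^d compensates the change of
  sign.\<close>

lemma weight_symmetric:
  fixes p N k :: nat and q :: complex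
  assumes q: "primitive_root_of_unity N q" and k: "k < N"
  defines "w \<equiv> \<lambda>k. (-1) ^ k * q ^ ((Suc k choose 2) + p * (k\<^sup>2 + k))"
  shows "w (N - 1 - k) = w k"
proof -
  obtain h where h: "h \<noteq> 0" "h\<^sup>2 = q" "h ^ N = -1" using exists_half_root[OF q] .
  have w: "w j = (-1) ^ j * h ^ ((2 * p + 1) * (j * (j + 1)))" for j
  proof -
    have "2 * (Suc j choose 2) = j * (j + 1)" by (induction j) (auto simp: choose_two_Suc numeral_2_eq_2)
    then have "2 * ((Suc j choose 2) + p * (j\<^sup>2 + j)) = (2 * p + 1) * (j * (j + 1))"
      by (simp add: algebra_simps power2_eq_square)
    then show ?thesis unfolding w_def h(2)[symmetric] power_mult[symmetric] by simp
  qed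
  define r where "r = N - 1 - k"
  have N: "N = r + k + 1" using k by (simp add: r_def)
  have sym: "w a = w b" if N: "N = a + b + 1" and ba: "b \<le> a" for a b
  proof -
    obtain d where a: "a = b + d" using ba le_Suc_ex by blast
    have e: "a * (a + 1) = b * (b + 1) + N * d" unfolding N a by (simp add: algebra_simps)
    have "(h ^ N) ^ (d * (2 * p + 1)) = (-1) ^ d" unfolding h by (simp add: minus_one_power_iff)
    then have "h ^ (N * (d * (2 * p + 1))) = (-1) ^ d" by (simp only: power_mult)
    moreover have "N * (d * (2 * p + 1)) = (2 * p + 1) * (N * d)" by (simp only: mult_ac)
    ultimately have "h ^ ((2 * p + 1) * (N * d)) = (-1) ^ d" by (simp only:)
    then show ?thesis unfolding w e distrib_left[of "2 * p + 1"] power_add by (simp add: a power_add)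
  qed
  show ?thesis unfolding r_def [symmetric]
  proof (cases "k \<le> r")
    case True
    then show "w r = w k" using N by (intro sym) auto
  next
    case False
    then show "w r = w k" using N by (intro sym [symmetric]) auto
  qed
qed

subsection \<open>The multiple sum\<close>

definition chains_to :: "nat \<Rightarrow> nat \<Rightarrow> (nat \<Rightarrow> nat) set" where
  "chains_to p n = {f \<in> index_chains p. f p = n}"

lemma finite_chains_to: "p \<ge> 1 \<Longrightarrow> finite (chains_to p n)"
proof (rule finite_subset)
  assume p: "p \<ge> 1"
  show "chains_to p n \<subseteq> {1..p} \<rightarrow>\<^sub>E {..n}"
  proof
    fix f assume f: "f \<in> chains_to p n"
    then have "f i \<le> n" if "i \<in> {1..p}" for i
      using that p by (auto simp: chains_to_def index_chains_def mono_on_def)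
    then show "f \<in> {1..p} \<rightarrow>\<^sub>E {..n}"
      using f by (auto simp: chains_to_def index_chains_def PiE_iff)
  qed
qed (auto intro: finite_PiE)

text \<open>Removing the top entry \<open>n\<close> of a chain leaves a shorter chain with top
  \<open>m\<close> at most \<open>n\<close>, which is the recursion of
  \<open>inner_sum\<close>.\<close>

lemma sum_chains_to:
  "(\<Sum>f\<in>chains_to (Suc j) n. \<Prod>i=1..j. q ^ (f i * (f i + 1)) * qbinom q (f (i + 1)) (f i)) =
    inner_sum q j n"
proof (induction j arbitrary: n)
  case 0
  have "chains_to (Suc 0) n = {restrict (\<lambda>_. n) {Suc 0}}"
    by (auto simp: chains_to_def index_chains_def mono_on_def PiE_iff extensional_def)
  then show ?case by simp
next
  case (Suc j)
  let ?g = "\<lambda>f i. q ^ (f i * (f i + 1)) * qbinom q (f (i + 1)) (f i)"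
  have "(\<Sum>f\<in>chains_to (Suc (Suc j)) n. \<Prod>i=1..Suc j. ?g f i) =
      (\<Sum>(m, f)\<in>Sigma {..n} (chains_to (Suc j)). q ^ (m * (m + 1)) * qbinom q n m * (\<Prod>i=1..j. ?g f i))"
  proof (rule sum.reindex_bij_witness[of _ "\<lambda>(m, f). f(Suc (Suc j) := n)"
        "\<lambda>f. (f (Suc j), restrict f {1..Suc j})"])
    fix f assume f: "f \<in> chains_to (Suc (Suc j)) n"
    then have ext: "f i = undefined" if "i \<notin> {1..Suc (Suc j)}" for i
      using that by (auto simp: chains_to_def index_chains_def PiE_iff extensional_def)
    have fn: "f (Suc (Suc j)) = n" using f by (simp add: chains_to_def)
    show "(case (f (Suc j), restrict f {1..Suc j}) of (m, f) \<Rightarrow> f(Suc (Suc j) := n)) = f"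
    proof
      fix i
      show "(case (f (Suc j), restrict f {1..Suc j}) of (m, f) \<Rightarrow> f(Suc (Suc j) := n)) i = f i"
        using fn ext[of i] by (auto simp: restrict_def le_Suc_eq)
    qed
    show "(f (Suc j), restrict f {1..Suc j}) \<in> Sigma {..n} (chains_to (Suc j))"
      using f by (auto simp: chains_to_def index_chains_def mono_on_def)
    have "(\<Prod>i=1..j. ?g (restrict f {1..Suc j}) i) = (\<Prod>i=1..j. ?g f i)"
      by (intro prod.cong) auto
    then show "(case (f (Suc j), restrict f {1..Suc j}) of (m, f) \<Rightarrow>
        q ^ (m * (m + 1)) * qbinom q n m * (\<Prod>i=1..j. ?g f i)) = (\<Prod>i=1..Suc j. ?g f i)"
      using fn by (simp add: mult_ac)
  next
    fix b assume "b \<in> Sigma {..n} (chains_to (Suc j))"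
    then obtain m f where b: "b = (m, f)" "m \<le> n" "f \<in> chains_to (Suc j) m" by auto
    then have ext: "f i = undefined" if "i \<notin> {1..Suc j}" for i
      using that by (auto simp: chains_to_def index_chains_def PiE_iff extensional_def)
    have fm: "f (Suc j) = m" and mono: "mono_on {1..Suc j} f"
      using b by (auto simp: chains_to_def index_chains_def)
    have "restrict (f(Suc (Suc j) := n)) {1..Suc j} = f"
      using ext by (auto simp: fun_eq_iff)
    then show "((case b of (m, f) \<Rightarrow> f(Suc (Suc j) := n)) (Suc j),
        restrict (case b of (m, f) \<Rightarrow> f(Suc (Suc j) := n)) {1..Suc j}) = b"
      using fm by (simp add: b)
    have le: "f i \<le> n" if "i \<in> {1..Suc j}" for i
      using mono_onD[OF mono that, of "Suc j"] that fm b(2) by auto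
    have "mono_on {1..Suc (Suc j)} (f(Suc (Suc j) := n))"
      using mono le by (auto simp: mono_on_def)
    then show "(case b of (m, f) \<Rightarrow> f(Suc (Suc j) := n)) \<in> chains_to (Suc (Suc j)) n"
      using ext by (auto simp: b chains_to_def index_chains_def PiE_iff extensional_def)
  qed
  also have "\<dots> = (\<Sum>m\<le>n. \<Sum>f\<in>chains_to (Suc j) m. q ^ (m * (m + 1)) * qbinom q n m * (\<Prod>i=1..j. ?g f i))"
    by (rule sum.Sigma [symmetric]) (auto simp: finite_chains_to)
  also have "\<dots> = inner_sum q (Suc j) n"
    unfolding sum_distrib_left [symmetric] Suc by simp
  finally show ?case .
qed

section \<open>Vanishing terms and reduction to a finite sum\<close>

lemma qfact_double: "qfact q (2 * n) = qfact q n * qpoch q (q ^ (n + 1)) n"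
proof -
  have "qpoch q (q ^ (n + 1)) n = (\<Prod>k=1..n. 1 - q ^ (n + k))"
    unfolding qpoch_def
  proof (intro prod.cong refl)
    fix k assume "k \<in> {1..n}"
    then have "n + 1 + (k - 1) = n + k" by simp
    then show "1 - q ^ (n + 1) * q ^ (k - 1) = 1 - q ^ (n + k)"
      by (simp only: power_add [symmetric])
  qed
  also have "\<dots> = (\<Prod>k=Suc n..2 * n. 1 - q ^ k)"
    by (rule prod.reindex_bij_witness[of _ "\<lambda>k. k - n" "\<lambda>k. k + n"]) (auto simp: add.commute)
  finally show ?thesis by (simp add: qfact_split[of n "2 * n"])
qed

text \<open>Sharpens the bound of \<open>H3_term_eq_0\<close> by a factor of two: for n =
  \<open>f p\<close> below \<open>N\<close> with 2n at least \<open>N\<close>, (q)_(2n) contains 1 -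
  q^N = 0 while (q)_n is nonzero. What survives has 2n < N, as the Bailey lemmas demand.\<close>

lemma H3_term_eq_0':
  assumes q: "primitive_root_of_unity N q" and n: "N \<le> 2 * f p"
  shows "H3_term p q f = 0"
proof (cases "N \<le> f p")
  case True
  then show ?thesis using H3_term_eq_0[of N q f p] q by simp
next
  case False
  have "qfact q (f p) \<noteq> 0"
    using False q by (intro qfact_nonzero[of "f p"] primitive_root_neq_1[of N]) auto
  moreover have "qfact q (2 * f p) = 0"
    unfolding qfact_eq using q n by (intro prod_zero) (auto simp: primitive_root_of_unity_def)
  ultimately have "qpoch q (q ^ (f p + 1)) (f p) = 0" by (simp add: qfact_double)
  then show ?thesis by (simp add: H3_term_def)
qed

lemma H3_eq_sum:
  assumes q: "primitive_root_of_unity N q" and p: "p \<ge> 1"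
  shows "H3 p q = (\<Sum>n\<le>(N - 1) div 2. q ^ (2 * n) * qpoch q (q ^ (n + 1)) n * inner_sum q (p - 1) n)"
proof -
  define M where "M = (N - 1) div 2"
  define A where "A = {f \<in> index_chains p. f p \<le> M}"
  have "A = (\<Union>n\<le>M. chains_to p n)" by (auto simp: A_def chains_to_def)
  then have fin: "finite A" by (simp only:) (intro finite_UN_I finite_atMost finite_chains_to p)
  have "H3_term p q f = 0" if "f \<in> index_chains p - A" for f
  proof -
    have "f p > M" using that by (auto simp: A_def)
    then have "N \<le> 2 * f p" unfolding M_def by presburger
    then show ?thesis by (rule H3_term_eq_0'[OF q])
  qed
  then have "H3 p q = infsum (H3_term p q) A"
    unfolding H3_def by (intro infsum_cong_neutral) (auto simp: A_def)
  also have "\<dots> = sum (H3_term p q) A" using fin by (rule infsum_finite)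
  also have "\<dots> = (\<Sum>n\<le>M. sum (H3_term p q) {f \<in> A. f p = n})"
    by (rule sum.group [symmetric]) (use fin in \<open>auto simp: A_def\<close>)
  also have "\<dots> = (\<Sum>n\<le>M. q ^ (2 * n) * qpoch q (q ^ (n + 1)) n * inner_sum q (p - 1) n)"
  proof (intro sum.cong refl)
    fix n assume n: "n \<in> {..M}"
    have "{f \<in> A. f p = n} = chains_to (Suc (p - 1)) n"
      using n p by (auto simp: A_def chains_to_def)
    then have "sum (H3_term p q) {f \<in> A. f p = n} = (\<Sum>f\<in>chains_to (Suc (p - 1)) n.
        q ^ (2 * n) * qpoch q (q ^ (n + 1)) n *
        (\<Prod>i=1..p-1. q ^ (f i * (f i + 1)) * qbinom q (f (i + 1)) (f i)))"
      using p by (intro sum.cong) (auto simp: H3_term_def chains_to_def)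
    then show "sum (H3_term p q) {f \<in> A. f p = n} =
        q ^ (2 * n) * qpoch q (q ^ (n + 1)) n * inner_sum q (p - 1) n"
      by (simp only: sum_distrib_left [symmetric] sum_chains_to)
  qed
  finally show ?thesis unfolding M_def .
qed

text \<open>After \<open>inner_sum_eq\<close> and an exchange of sums, the difference defining
  \<open>bailey_kernel\<close> separates two consecutive blocks: q^(k^2) q^(2k+1) = q^((k+1)^2) is
  the prefactor of the second.\<close>

lemma H3_eq_theta_blocks:
  assumes q: "primitive_root_of_unity N q" and p: "p \<ge> 1"
  shows "H3 p q = (\<Sum>k\<le>(N - 1) div 2. (-1) ^ k * q ^ ((Suc k choose 2) + (p - 1) * (k\<^sup>2 + k)) *
    (theta_block N q k - theta_block N q (Suc k)))"
proof -
  define M where "M = (N - 1) div 2"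
  define c where "c = (\<lambda>k. (-1) ^ k * q ^ ((k choose 2) + p * (k\<^sup>2 + k)))"
  have N: "N > 0" using q by (simp add: primitive_root_of_unity_def)
  have inner: "qpoch q (q ^ (n + 1)) n * inner_sum q (p - 1) n =
      qfact q (2 * n) * (\<Sum>k\<le>n. c k * bailey_kernel q k n)" if "n \<le> M" for n
  proof -
    have "2 * n < N" using that N unfolding M_def by presburger
    then have "inner_sum q (p - 1) n = qfact q n * (\<Sum>k\<le>n. c k * bailey_kernel q k n)"
      unfolding c_def using p q by (subst inner_sum_eq) (auto dest: primitive_root_neq_1)
    then show ?thesis by (simp add: qfact_double)
  qed
  let ?u = "\<lambda>n. q ^ (2 * n) * qfact q (2 * n)"
  have "H3 p q = (\<Sum>n\<le>M. q ^ (2 * n) * (qpoch q (q ^ (n + 1)) n * inner_sum q (p - 1) n))"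
    unfolding H3_eq_sum[OF q p] M_def by (simp only: mult.assoc)
  also have "\<dots> = (\<Sum>n\<le>M. \<Sum>k\<le>n. c k * (?u n * bailey_kernel q k n))"
  proof (intro sum.cong refl)
    fix n assume "n \<in> {..M}"
    then have "q ^ (2 * n) * (qpoch q (q ^ (n + 1)) n * inner_sum q (p - 1) n) =
        ?u n * (\<Sum>k\<le>n. c k * bailey_kernel q k n)"
      by (simp only: inner atMost_iff mult.assoc)
    then show "q ^ (2 * n) * (qpoch q (q ^ (n + 1)) n * inner_sum q (p - 1) n) =
        (\<Sum>k\<le>n. c k * (?u n * bailey_kernel q k n))"
      by (simp add: sum_distrib_left mult_ac)
  qed
  also have "\<dots> = (\<Sum>k\<le>M. \<Sum>n=k..M. c k * (?u n * bailey_kernel q k n))"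
    unfolding sum.Sigma[OF finite_atMost ballI[OF finite_atMost]] sum.Sigma[OF finite_atMost ballI[OF finite_atLeastAtMost]]
    by (rule sum.reindex_bij_witness[of _ prod.swap prod.swap]) auto
  also have "\<dots> = (\<Sum>k\<le>M. (-1) ^ k * q ^ ((Suc k choose 2) + (p - 1) * (k\<^sup>2 + k)) *
    (theta_block N q k - theta_block N q (Suc k)))"
  proof (intro sum.cong refl)
    fix k assume k: "k \<in> {..M}"
    \<comment> \<open>The summand at \<open>n = k\<close> is 0, so the range fits
      \<open>theta_block\<close> at \<open>Suc k\<close>.\<close>
    have *: "(\<Sum>n=k..M. ?u n * bailey_aux q (Suc k) n) = (\<Sum>n=Suc k..M. ?u n * bailey_aux q (Suc k) n)"
      using k by (simp add: sum.atLeast_Suc_atMost bailey_aux_def)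
    have "(\<Sum>n=k..M. c k * (?u n * bailey_kernel q k n)) = c k *
       ((\<Sum>n=k..M. ?u n * bailey_aux q k n) - q ^ (2 * k + 1) * (\<Sum>n=k..M. ?u n * bailey_aux q (Suc k) n))"
      by (simp only: bailey_kernel_def sum_distrib_left right_diff_distrib sum_subtractf mult_ac)
    moreover have "(k choose 2) + p * (k\<^sup>2 + k) = (Suc k choose 2) + (p - 1) * (k\<^sup>2 + k) + k\<^sup>2"
      using p by (cases p) (auto simp: choose_two_Suc algebra_simps)
    then have "c k = (-1) ^ k * q ^ ((Suc k choose 2) + (p - 1) * (k\<^sup>2 + k)) * q ^ (k\<^sup>2)"
      by (simp only: c_def power_add [symmetric] mult.assoc)
    moreover have "(Suc k)\<^sup>2 = k\<^sup>2 + (2 * k + 1)" by (simp add: power2_eq_square)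
    then have "q ^ ((Suc k)\<^sup>2) = q ^ (k\<^sup>2) * q ^ (2 * k + 1)" by (simp only: power_add)
    ultimately show "(\<Sum>n=k..M. c k * (?u n * bailey_kernel q k n)) =
        (-1) ^ k * q ^ ((Suc k choose 2) + (p - 1) * (k\<^sup>2 + k)) *
        (theta_block N q k - theta_block N q (Suc k))"
      unfolding theta_block_def M_def [symmetric] * by (simp only: right_diff_distrib mult.assoc)
  qed
  finally show ?thesis unfolding M_def .
qed

theorem theorem2p9:
  fixes p N :: nat and q :: complex
  assumes "p \<ge> 1" and "N \<ge> 1" and "primitive_root_of_unity N q"
  shows "H3 p q = inverse q *
    (\<Sum>k=0..N-1. (-1) ^ k * q ^ (((k + 1) choose 2) + (p - 1) * (k^2 + k)) * alpha q k)"
proof -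
  note q = assms(3)
  define w where "w = (\<lambda>k. (-1) ^ k * q ^ ((Suc k choose 2) + (p - 1) * (k\<^sup>2 + k)))"
  define t where "t = (\<lambda>k. q * theta_block N q k)"
  have "q ^ N = 1" using q by (simp add: primitive_root_of_unity_def)
  then have q0: "q \<noteq> 0" using assms(2) by (auto simp: power_0_left)
  \<comment> \<open>The factor \<open>q\<close> is moved to the left because
    \<open>theta_block_eq\<close> evaluates \<open>q * theta_block N q k\<close>.\<close>
  have "q * H3 p q = (\<Sum>k\<le>(N - 1) div 2. w k * (t k - t (Suc k)))"
    unfolding H3_eq_theta_blocks[OF q assms(1)] sum_distrib_left
    by (intro sum.cong refl) (simp add: w_def t_def algebra_simps)
  also have "\<dots> = (\<Sum>k<N. w k * alpha q k)"
  proof (rule symmetric_sum_by_parts)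
    show "w (N - 1 - k) = w k" if "k < N" for k
      unfolding w_def by (rule weight_symmetric[OF q that])
    show "t k = (\<Sum>j<N - k. alpha q j) - (\<Sum>j<k. alpha q j)" if "2 * k < N" for k
      using theta_block_eq[OF q that] by (simp add: t_def alpha_sum_def)
    show "t (Suc ((N - 1) div 2)) = 0" by (simp add: t_def theta_block_def)
  qed (use assms in simp)
  also have "{..<N} = {0..N - 1}" using assms(2) by auto
  finally show ?thesis using q0 by (simp add: w_def field_simps)
qed

end
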